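(* There are only exponentially many shellable simplicial $3$-spheres with given number of facets: there is a constant $C$ such that, for every $N$, there are at most $C^N$ combinatorial types of shellable simplicial $3$-spheres with $N$ facets.
   Context: All complexes are finite. A simplicial $3$-sphere is a simplicial complex whose underlying space is homeomorphic to the $3$-sphere; facets are its $3$-dimensional faces. Combinatorial types are isomorphism classes of simplicial complexes. Shellable: every simplex is shellable; a pure $d$-dimensional simplicial complex $C$ that is not a simplex is shellable iff $C=C_1\cup C_2$ with $C_1$ a shellable $d$-complex, $C_2$ a $d$-simplex, and $C_1\cap C_2$ a shellable $(d-1)$-complex. *)

theory Defs
  imports "HOL-Analysis.Analysis"
begin

text \<open>Complexes are abstract and finite. Combinatorial types are to be counted without reference to
  an ambient space, whereas a geometric complex would live in one euclidean space fixed by its type.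
  The empty face always belongs to a complex; it is the simplex of dimension -1.\<close>

definition abstract_complex :: "'a set set \<Rightarrow> bool" where
  "abstract_complex K \<longleftrightarrow>
     finite K \<and> {} \<in> K \<and> (\<forall>\<sigma>\<in>K. finite \<sigma>) \<and> (\<forall>\<sigma>\<in>K. \<forall>\<tau>. \<tau> \<subseteq> \<sigma> \<longrightarrow> \<tau> \<in> K)"

definition face_dim :: "'a set \<Rightarrow> int" where
  "face_dim \<sigma> = int (card \<sigma>) - 1"

definition pure_complex :: "int \<Rightarrow> 'a set set \<Rightarrow> bool" where
  "pure_complex d K \<longleftrightarrow>
     abstract_complex K \<and> (\<forall>\<sigma>\<in>K. (\<forall>\<tau>\<in>K. \<sigma> \<subseteq> \<tau> \<longrightarrow> \<tau> = \<sigma>) \<longrightarrow> face_dim \<sigma> = d)"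

definition simplex_complex :: "int \<Rightarrow> 'a set set \<Rightarrow> bool" where
  "simplex_complex d K \<longleftrightarrow> (\<exists>\<sigma>. finite \<sigma> \<and> face_dim \<sigma> = d \<and> K = Pow \<sigma>)"

text \<open>\<open>shellable_complex d K\<close>: the complex \<open>K\<close> is a shellable \<open>d\<close>-complex. The recursion in the
  dimension ends at \<open>d = -1\<close>, where the only complex is the simplex \<open>{{}}\<close>; so a new point may be
  glued to a shellable 0-complex along the empty face.\<close>

inductive shellable_complex :: "int \<Rightarrow> 'a set set \<Rightarrow> bool" where
  simplexI: "simplex_complex d C \<Longrightarrow> shellable_complex d C"
| glueI: "\<lbrakk>pure_complex d (C1 \<union> C2); \<nexists>e. simplex_complex e (C1 \<union> C2);
           shellable_complex d C1; simplex_complex d C2;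
           shellable_complex (d - 1) (C1 \<inter> C2)\<rbrakk>
          \<Longrightarrow> shellable_complex d (C1 \<union> C2)"

definition shellable :: "'a set set \<Rightarrow> bool" where
  "shellable K \<longleftrightarrow> (\<exists>d. shellable_complex d K)"

text \<open>The underlying space, in barycentric coordinates. Since \<open>K\<close> is finite, the topology
  of pointwise convergence of coordinates is the usual one.\<close>

definition underlying_space :: "'a set set \<Rightarrow> ('a \<Rightarrow> real) topology" where
  "underlying_space K = subtopology (powertop_real UNIV)
     {t. (\<forall>v. 0 \<le> t v) \<and> {v. t v \<noteq> 0} \<in> K \<and> (\<Sum>v | t v \<noteq> 0. t v) = 1}"

definition simplicial_3_sphere :: "'a set set \<Rightarrow> bool" where
  "simplicial_3_sphere K \<longleftrightarrow>
     abstract_complex K \<and> underlying_space K homeomorphic_space nsphere 3"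

definition sphere_facets :: "'a set set \<Rightarrow> 'a set set" where
  "sphere_facets K = {\<sigma> \<in> K. face_dim \<sigma> = 3}"

definition complex_iso :: "('a set set \<times> 'a set set) set" where
  "complex_iso = {(K, L). abstract_complex K \<and> abstract_complex L \<and>
     (\<exists>f. bij_betw f (\<Union>K) (\<Union>L) \<and> (\<lambda>\<sigma>. f ` \<sigma>) ` K = L)}"

text \<open>Vertices may be taken to be natural numbers: see \<open>complex_has_nat_copy\<close> below.\<close>

definition shellable_3_sphere_types :: "nat \<Rightarrow> nat set set set set" where
  "shellable_3_sphere_types N =
     {K. simplicial_3_sphere K \<and> shellable K \<and> card (sphere_facets K) = N} // complex_iso"

lemma equiv_complex_iso: "equiv {K :: 'a set set. abstract_complex K} complex_iso"
proof (rule equivI)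
  show "refl_on {K :: 'a set set. abstract_complex K} complex_iso"
  proof (rule refl_onI)
    fix K :: "'a set set" assume "K \<in> {K. abstract_complex K}"
    moreover have "bij_betw id (\<Union>K) (\<Union>K)" "(\<lambda>\<sigma>. id ` \<sigma>) ` K = K"
      by simp_all
    ultimately show "(K, K) \<in> complex_iso"
      unfolding complex_iso_def by blast
  qed
  show "sym (complex_iso :: ('a set set \<times> 'a set set) set)"
  proof (rule symI)
    fix K L :: "'a set set" assume "(K, L) \<in> complex_iso"
    then obtain f where K: "abstract_complex K" and L: "abstract_complex L"
      and f: "bij_betw f (\<Union>K) (\<Union>L)" and im: "(\<lambda>\<sigma>. f ` \<sigma>) ` K = L"
      unfolding complex_iso_def by blast
    let ?g = "inv_into (\<Union>K) f"
    have "?g ` f ` \<sigma> = \<sigma>" if "\<sigma> \<in> K" for \<sigma>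
      using that f by (intro inv_into_image_cancel) (auto simp: bij_betw_def)
    then have "(\<lambda>\<sigma>. ?g ` \<sigma>) ` L = K"
      unfolding im[symmetric] image_image by simp
    with K L bij_betw_inv_into[OF f] show "(L, K) \<in> complex_iso"
      unfolding complex_iso_def by blast
  qed
  show "trans (complex_iso :: ('a set set \<times> 'a set set) set)"
  proof (rule transI)
    fix K L M :: "'a set set" assume "(K, L) \<in> complex_iso" "(L, M) \<in> complex_iso"
    then obtain f g where A: "abstract_complex K" "abstract_complex M"
      and f: "bij_betw f (\<Union>K) (\<Union>L)" "(\<lambda>\<sigma>. f ` \<sigma>) ` K = L"
      and g: "bij_betw g (\<Union>L) (\<Union>M)" "(\<lambda>\<sigma>. g ` \<sigma>) ` L = M"
      unfolding complex_iso_def by blast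
    have "bij_betw (g \<circ> f) (\<Union>K) (\<Union>M)"
      using f(1) g(1) by (rule bij_betw_trans)
    moreover have "(\<lambda>\<sigma>. (g \<circ> f) ` \<sigma>) ` K = M"
      using f(2) g(2) by (auto simp: image_image image_comp)
    ultimately show "(K, M) \<in> complex_iso"
      using A unfolding complex_iso_def by blast
  qed
qed (auto simp: complex_iso_def)

lemma complex_has_nat_copy:
  fixes K :: "'a set set"
  assumes "abstract_complex K"
  obtains L :: "nat set set" and f where
    "abstract_complex L" "bij_betw f (\<Union>K) (\<Union>L)" "(\<lambda>\<sigma>. f ` \<sigma>) ` K = L"
proof -
  have "finite (\<Union>K)"
    using assms by (auto simp: abstract_complex_def)
  then obtain f :: "'a \<Rightarrow> nat" where f: "inj_on f (\<Union>K)"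
    by (metis finite_imp_inj_to_nat_seg)
  let ?L = "(\<lambda>\<sigma>. f ` \<sigma>) ` K"
  have "\<tau> \<in> ?L" if "\<sigma> \<in> K" "\<tau> \<subseteq> f ` \<sigma>" for \<sigma> \<tau>
  proof -
    obtain \<rho> where "\<rho> \<subseteq> \<sigma>" "\<tau> = f ` \<rho>"
      using \<open>\<tau> \<subseteq> f ` \<sigma>\<close> by (auto simp: subset_image_iff)
    moreover have "\<rho> \<in> K"
      using assms \<open>\<sigma> \<in> K\<close> \<open>\<rho> \<subseteq> \<sigma>\<close> unfolding abstract_complex_def by blast
    ultimately show ?thesis
      by blast
  qed
  moreover have "finite ?L" "{} \<in> ?L" "\<forall>\<sigma>\<in>?L. finite \<sigma>"
    using assms unfolding abstract_complex_def by (simp_all add: image_iff)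
  ultimately have "abstract_complex ?L"
    unfolding abstract_complex_def by blast
  moreover have "bij_betw f (\<Union>K) (\<Union>?L)"
    using f by (simp add: bij_betw_def image_Union)
  ultimately show thesis
    using that by blast
qed

end

theory Submission
  imports "HOL-Homology.Invariance_of_Domain" Defs
begin

text \<open>A shelling presents the sphere as a tree of tetrahedra, each glued to an earlier one along a
  triangle, with further identifications of triangles. If a new tetrahedron meets the earlier ones in
  several triangles, each of them after the first shares an edge with the first, and the edge is then
  surrounded by tetrahedra. So the edge determines the identification: marking, for every such
  triangle, the edge that causes its gluing leaves no freedom, since by thinness (at most two
  tetrahedra at a triangle) an edge gets surrounded only once. The tree is a set of words over four
  letters and the marks are boundedly many bits per tetrahedron, which gives an exponential bound. Of
  the topology of the sphere only the dimension and thinness are used; both come from invariance of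
  domain, applied to the cone over the complex, which is homeomorphic to 4-space without origin.\<close>

section \<open>Dimension and thinness of simplicial 3-spheres\<close>

text \<open>The obstacle is the shelling order: recording it would cost factorially many
  possibilities, so it must not enter the code. Facets are therefore named by words instead of
  positions, the marks form a plain set, and the gluing rule is a condition on the finished complex:
  marked triangles with the same edge have the same third vertex. Such a rule makes sense without
  knowing when an edge was surrounded. Decoding compares two labellings of one code: along a
  suitable order for the first, every coincidence of vertices is forced by the tree or by a mark,
  hence it also occurs in the second. Exchanging the two labellings, whose orders may be unrelated,
  gives the isomorphism. It suffices to follow vertices. A new tetrahedron has one vertex outside
  its parent, and if that vertex is old, the shelling condition supplies another shared triangle
  that contains it.\<close>

definition coord_space :: "nat \<Rightarrow> (nat \<Rightarrow> real) set" where
  "coord_space n = {x. \<forall>i\<ge>n. x i = 0}"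

lemma Euclidean_space_eq_top_of_set: "Euclidean_space n = top_of_set (coord_space n)"
  by (simp add: Euclidean_space_def coord_space_def euclidean_product_topology)

lemma invariance_of_domain_coord_space:
  assumes "openin (top_of_set (coord_space n)) U" "continuous_on U f"
    "f ` U \<subseteq> coord_space n" "inj_on f U"
  shows "openin (top_of_set (coord_space n)) (f ` U)"
proof -
  have "subtopology (top_of_set (coord_space n)) U = top_of_set U"
    using openin_imp_subset[OF assms(1)] by (simp add: subtopology_subtopology Int_absorb1)
  then show ?thesis
    using invariance_of_domain_Euclidean_space[of n U f] assms
    by (simp add: Euclidean_space_eq_top_of_set image_subset_iff_funcset)
qed

text \<open>If n < m, invariance of domain makes the image open in \<open>coord_space m\<close>,
  although it lies in the proper subspace \<open>coord_space n\<close>. All dimensions live in one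
  type, so the two spaces are comparable by inclusion.\<close>

lemma invariance_of_dimension_coord_space:
  assumes U: "openin (top_of_set (coord_space m)) U" "U \<noteq> {}"
    and f: "continuous_on U f" "f ` U \<subseteq> coord_space n" "inj_on f U"
  shows "m \<le> n"
proof (rule ccontr)
  assume "\<not> m \<le> n"
  then have "n < m" by simp
  then have "coord_space n \<subseteq> coord_space m"
    by (auto simp: coord_space_def)
  then have "openin (top_of_set (coord_space m)) (f ` U)"
    using invariance_of_domain_coord_space[OF U(1) f(1) _ f(3)] f(2) by blast
  then obtain W where W: "open W" "f ` U = coord_space m \<inter> W"
    by (auto simp: openin_open)
  obtain y where y: "y \<in> f ` U" using U(2) by blast
  \<comment> \<open>Coordinate \<open>n\<close> vanishes on \<open>coord_space n\<close> but is free
    in \<open>coord_space m\<close>: a small move of \<open>y\<close> along it stays in the image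
    and yet leaves \<open>coord_space n\<close>.\<close>
  define p :: "real \<Rightarrow> nat \<Rightarrow> real" where "p = (\<lambda>r. y(n := r))"
  have "continuous_on UNIV p"
    unfolding p_def fun_upd_def
  proof (intro continuous_on_coordinatewise_then_product)
    show "continuous_on UNIV (\<lambda>r. if i = n then r else y i)" for i
      by (cases "i = n") (auto intro: continuous_intros)
  qed
  then have "open (p -` W)"
    using W(1) by (simp add: continuous_on_open_vimage)
  moreover have "y n = 0" using y f(2) by (auto simp: coord_space_def)
  then have "p 0 = y" by (auto simp: p_def)
  then have "0 \<in> p -` W" using y W by auto
  ultimately obtain e where "e > 0" "ball 0 e \<subseteq> p -` W"
    by (metis open_contains_ball)
  then have "p (e/2) \<in> W" by (auto simp: subset_iff dist_real_def)
  moreover have "p (e/2) \<in> coord_space m"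
    using y W(2) \<open>n < m\<close> by (auto simp: p_def coord_space_def)
  ultimately have "p (e/2) \<in> coord_space n" using W(2) f(2) by blast
  then show False using \<open>e > 0\<close> by (auto simp: coord_space_def p_def)
qed

section \<open>The open cone over a complex\<close>

text \<open>The cone over the underlying space, without its apex. Leaving out the normalisation
  gives the interior of a face with n vertices n independent positive coordinates, so charts can be
  written down coordinate by coordinate.\<close>

definition open_cone :: "'a set set \<Rightarrow> ('a \<Rightarrow> real) set" where
  "open_cone K = {t. (\<forall>v. 0 \<le> t v) \<and> {v. t v \<noteq> 0} \<in> K \<and> {v. t v \<noteq> 0} \<noteq> {}}"

lemma continuous_on_coord:
  "continuous_on S f \<Longrightarrow> continuous_on S (\<lambda>x. f x i)"
  by (rule continuous_on_product_then_coordinatewise)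

lemma continuous_on_apply:
  "continuous_on S (\<lambda>x :: 'a \<Rightarrow> real. x i)"
  by (rule continuous_on_coord) (rule continuous_on_id)

text \<open>Invariance of domain is to be applied in euclidean space, not on the sphere. Radial
  extension makes this possible: rays go to rays, and the coordinate sum becomes the euclidean
  norm.\<close>

lemma sphere_cone_homeomorphism:
  assumes K: "simplicial_3_sphere K"
  obtains H G where "homeomorphism (open_cone K) (coord_space 4 - {\<lambda>_. 0}) H G"
proof -
  define T where "T = {t. (\<forall>v. 0 \<le> t v) \<and> {v. t v \<noteq> 0} \<in> K \<and> (\<Sum>v | t v \<noteq> 0. t v) = (1::real)}"
  define S where "S = {x :: nat \<Rightarrow> real. (\<Sum>i\<le>3. x i ^ 2) = 1 \<and> (\<forall>i>3. x i = 0)}"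
  have "underlying_space K = top_of_set T" "nsphere 3 = top_of_set S"
    by (simp_all add: underlying_space_def T_def nsphere S_def euclidean_product_topology)
  then have "top_of_set T homeomorphic_space top_of_set S"
    using K by (simp add: simplicial_3_sphere_def)
  then obtain h g where hg: "homeomorphism T S h g"
    by (auto simp: homeomorphic_space_def)
  have fin: "finite (\<Union>K)" and sub: "\<And>\<sigma>. \<sigma> \<in> K \<Longrightarrow> \<sigma> \<subseteq> \<Union>K"
    using K by (auto simp: simplicial_3_sphere_def abstract_complex_def)
  \<comment> \<open>Summing over all vertices instead of the support makes \<open>s\<close> visibly
    continuous; \<open>s_supp\<close> shows that the value is the same.\<close>
  define s where "s t = (\<Sum>v\<in>\<Union>K. t v)" for t :: "'a \<Rightarrow> real"
  define r where "r y = sqrt (\<Sum>i\<le>3. y i ^ 2)" for y :: "nat \<Rightarrow> real"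
  define H where "H t = (\<lambda>i. s t * h (\<lambda>v. t v / s t) i)" for t
  define G where "G y = (\<lambda>v. r y * g (\<lambda>i. y i / r y) v)" for y
  let ?C = "open_cone K" and ?D = "coord_space 4 - {\<lambda>_. 0}"
  have s_supp: "s t = (\<Sum>v | t v \<noteq> 0. t v)" if "{v. t v \<noteq> 0} \<in> K" for t
    unfolding s_def using fin sub[OF that] by (intro sum.mono_neutral_right) auto
  have s_pos: "s t > 0" if "t \<in> ?C" for t
  proof -
    have "{v. t v \<noteq> 0} \<in> K" "{v. t v \<noteq> 0} \<noteq> {}" "\<And>v. 0 \<le> t v"
      using that by (auto simp: open_cone_def)
    then show ?thesis
      using finite_subset[OF sub fin] unfolding s_supp[OF \<open>_ \<in> K\<close>]
      by (intro sum_pos) (auto simp: order_le_less)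
  qed
  have s_T: "s t = 1" if "t \<in> T" for t
    using that s_supp by (auto simp: T_def)
  have s_scale: "s (\<lambda>v. c * t v) = c * s t" for c t
    by (simp add: s_def sum_distrib_left)
  have r_scale: "r (\<lambda>i. c * y i) = c * r y" if "c \<ge> 0" for c y
    using that by (simp add: r_def power_mult_distrib real_sqrt_mult flip: sum_distrib_left)
  have r_S: "r y = 1" if "y \<in> S" for y
    using that by (auto simp: S_def r_def)
  have r_pos: "r y > 0" if "y \<in> ?D" for y
  proof -
    have "y \<noteq> (\<lambda>_. 0)" using that by blast
    then obtain i where i: "y i \<noteq> 0" by (auto simp: fun_eq_iff)
    moreover have "i < 4" using that i by (force simp: coord_space_def not_le)
    ultimately have "(\<Sum>i\<le>3. y i ^ 2) > 0"
      by (intro sum_pos2[of _ i]) auto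
    then show ?thesis by (simp add: r_def)
  qed
  have scT: "(\<lambda>v. t v / s t) \<in> T" if "t \<in> ?C" for t
  proof -
    have "{v. t v / s t \<noteq> 0} = {v. t v \<noteq> 0}" using s_pos[OF that] by auto
    moreover have "s (\<lambda>v. t v / s t) = 1"
      using s_scale[of "1 / s t" t] s_pos[OF that] by simp
    ultimately show ?thesis
      using that s_pos[OF that] s_supp[of "\<lambda>v. t v / s t"] by (auto simp: T_def open_cone_def)
  qed
  have scS: "(\<lambda>i. y i / r y) \<in> S" if "y \<in> ?D" for y
  proof -
    have "r (\<lambda>i. y i / r y) = 1"
      using r_scale[of "1 / r y" y] r_pos[OF that] by simp
    then show ?thesis using that by (auto simp: S_def r_def coord_space_def)
  qed
  have T_C: "(\<lambda>v. c * t v) \<in> ?C" if "t \<in> T" "c > 0" for c t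
  proof -
    have "{v. c * t v \<noteq> 0} = {v. t v \<noteq> 0}" using that by auto
    moreover have "{v. t v \<noteq> 0} \<noteq> {}"
    proof
      assume "{v. t v \<noteq> 0} = {}"
      then have "s t = 0" by (simp add: s_def)
      then show False using s_T that by auto
    qed
    ultimately show ?thesis using that by (auto simp: T_def open_cone_def)
  qed
  have S_D: "(\<lambda>i. c * y i) \<in> ?D" if "y \<in> S" "c > 0" for c y
  proof -
    have "(\<lambda>i. c * y i) \<noteq> (\<lambda>_. 0)"
    proof
      assume "(\<lambda>i. c * y i) = (\<lambda>_. 0)"
      then have "y = (\<lambda>_. 0)" using that(2) by (auto simp: fun_eq_iff)
      then show False using that(1) by (simp add: S_def)
    qed
    then show ?thesis using that by (auto simp: S_def coord_space_def)
  qed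
  have hS: "h t \<in> S" "g (h t) = t" if "t \<in> T" for t
    using hg that by (auto simp: homeomorphism_def)
  have gT: "g y \<in> T" "h (g y) = y" if "y \<in> S" for y
    using hg that by (auto simp: homeomorphism_def)
  have cs: "continuous_on A s" for A
    unfolding s_def by (intro continuous_intros continuous_on_coord)
  have cr: "continuous_on A r" for A
    unfolding r_def by (intro continuous_intros continuous_on_coord)
  have "homeomorphism ?C ?D H G"
  proof (rule homeomorphismI)
    have "continuous_on ?C (\<lambda>t. h (\<lambda>v. t v / s t))"
    proof (rule continuous_on_compose2[where g=h and f="\<lambda>t v. t v / s t" and t=T])
      show "continuous_on T h" using hg by (auto simp: homeomorphism_def)
      show "continuous_on ?C (\<lambda>t v. t v / s t)"
      proof (rule continuous_on_coordinatewise_then_product)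
        show "continuous_on ?C (\<lambda>t. t v / s t)" for v
          using s_pos by (intro continuous_on_divide continuous_on_apply cs) force
      qed
    qed (use scT in blast)
    then show "continuous_on ?C H"
      unfolding H_def
      by (intro continuous_on_coordinatewise_then_product continuous_on_mult cs) (rule continuous_on_coord)
    have "continuous_on ?D (\<lambda>y. g (\<lambda>i. y i / r y))"
    proof (rule continuous_on_compose2[where g=g and f="\<lambda>y i. y i / r y" and t=S])
      show "continuous_on S g" using hg by (auto simp: homeomorphism_def)
      show "continuous_on ?D (\<lambda>y i. y i / r y)"
      proof (rule continuous_on_coordinatewise_then_product)
        show "continuous_on ?D (\<lambda>y. y i / r y)" for i
          using r_pos by (intro continuous_on_divide continuous_on_apply cr) force
      qed
    qed (use scS in blast)
    then show "continuous_on ?D G"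
      unfolding G_def
      by (intro continuous_on_coordinatewise_then_product continuous_on_mult cr) (rule continuous_on_coord)
    show "H ` ?C \<subseteq> ?D"
      unfolding H_def by (intro image_subsetI S_D hS(1) scT s_pos)
    show "G ` ?D \<subseteq> ?C"
      unfolding G_def by (intro image_subsetI T_C gT(1) scS r_pos)
    show "G (H t) = t" if "t \<in> ?C" for t
    proof -
      have pos: "s t > 0" by (rule s_pos[OF that])
      have "r (H t) = s t"
        unfolding H_def r_scale[OF less_imp_le[OF pos]] r_S[OF hS(1)[OF scT[OF that]]] by simp
      moreover have "(\<lambda>i. H t i / s t) = h (\<lambda>v. t v / s t)"
        using pos by (simp add: H_def)
      ultimately show ?thesis
        using pos hS(2)[OF scT[OF that]] by (simp add: G_def)
    qed
    show "H (G y) = y" if "y \<in> ?D" for y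
    proof -
      have pos: "r y > 0" by (rule r_pos[OF that])
      have "s (G y) = r y"
        unfolding G_def s_scale s_T[OF gT(1)[OF scS[OF that]]] by simp
      moreover have "(\<lambda>v. G y v / r y) = g (\<lambda>i. y i / r y)"
        using pos by (simp add: G_def)
      ultimately show ?thesis
        using pos gT(2)[OF scS[OF that]] by (simp add: H_def)
    qed
  qed
  then show thesis by (rule that)
qed

section \<open>Charts of the cone at maximal faces and at triangles\<close>

lemma open_all_coords_pos:
  assumes "finite F"
  shows "open {t :: 'a \<Rightarrow> real. \<forall>v\<in>F. 0 < t v}"
proof -
  have "open {t :: 'a \<Rightarrow> real. 0 < t v}" for v
    by (intro open_Collect_less continuous_intros continuous_on_coord)
  then have "open (\<Inter>v\<in>F. {t :: 'a \<Rightarrow> real. 0 < t v})"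
    using assms by (intro open_INT) auto
  moreover have "(\<Inter>v\<in>F. {t :: 'a \<Rightarrow> real. 0 < t v}) = {t. \<forall>v\<in>F. 0 < t v}" by auto
  ultimately show ?thesis by simp
qed

text \<open>The interior of a maximal face is open in the cone, hence a copy of an open part of
  4-space; it is also a copy of the positive orthant with one coordinate per vertex. Invariance of
  dimension, used in both directions, equates the dimensions.\<close>

lemma sphere_maximal_face_card:
  assumes K: "simplicial_3_sphere K"
    and F: "F \<in> K" "F \<noteq> {}" "\<And>\<tau>. \<tau> \<in> K \<Longrightarrow> F \<subseteq> \<tau> \<Longrightarrow> \<tau> = F"
  shows "card F = 4"
proof -
  obtain H G where HG: "homeomorphism (open_cone K) (coord_space 4 - {\<lambda>_. 0}) H G"
    using sphere_cone_homeomorphism[OF K] .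
  then have cH: "continuous_on (open_cone K) H" and cG: "continuous_on (coord_space 4 - {\<lambda>_. 0}) G"
    by (simp_all add: homeomorphism_def)
  have fF: "finite F" using K F by (auto simp: simplicial_3_sphere_def abstract_complex_def)
  define n where "n = card F"
  obtain e where e: "bij_betw e {..<n} F"
    using fF ex_bij_betw_nat_finite by (auto simp: n_def atLeast0LessThan)
  define e' where "e' = inv_into {..<n} e"
  have e': "\<And>v. v \<in> F \<Longrightarrow> e' v < n \<and> e (e' v) = v" "\<And>i. i < n \<Longrightarrow> e i \<in> F \<and> e' (e i) = i"
    using e by (auto simp: e'_def bij_betw_def inv_into_into f_inv_into_f inv_into_f_f)
  define Op where "Op = {t. (\<forall>v\<in>F. 0 < t v) \<and> (\<forall>v. v \<notin> F \<longrightarrow> t v = (0::real))}"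
  define P where "P = {x \<in> coord_space n. \<forall>i<n. 0 < x i}"
  define p where "p x = (\<lambda>v. if v \<in> F then x (e' v) else 0)" for x :: "nat \<Rightarrow> real"
  define q where "q t = (\<lambda>i. if i < n then t (e i) else (0::real))" for t
  have pP: "p x \<in> Op" if "x \<in> P" for x using that e' by (auto simp: p_def P_def Op_def)
  have qO: "q t \<in> P" if "t \<in> Op" for t using that e' by (auto simp: q_def P_def Op_def coord_space_def)
  have qp: "q (p x) = x" if "x \<in> P" for x
    using that e' by (auto simp: q_def p_def P_def coord_space_def fun_eq_iff)
  have pq: "p (q t) = t" if "t \<in> Op" for t
    using that e' by (auto simp: q_def p_def Op_def fun_eq_iff)
  have cp: "continuous_on A p" for A
    unfolding p_def
  proof (intro continuous_on_coordinatewise_then_product)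
    show "continuous_on A (\<lambda>x. if v \<in> F then x (e' v) else (0::real))" for v
      by (cases "v \<in> F") (simp_all add: continuous_on_max continuous_on_minus continuous_on_apply)
  qed
  have cq: "continuous_on A q" for A
    unfolding q_def
  proof (intro continuous_on_coordinatewise_then_product)
    show "continuous_on A (\<lambda>t. if i < n then t (e i) else (0::real))" for i
      by (cases "i < n") (simp_all add: continuous_on_max continuous_on_minus continuous_on_apply)
  qed
  have openP: "openin (top_of_set (coord_space n)) P"
  proof -
    have "P = coord_space n \<inter> {t. \<forall>v\<in>{..<n}. 0 < t v}" by (auto simp: P_def)
    then show ?thesis using open_all_coords_pos[of "{..<n}"] by (auto simp: openin_open)
  qed
  \<comment> \<open>Positivity on \<open>F\<close> is an open condition, and maximality of
    \<open>F\<close> keeps any further vertex out of the support.\<close>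
  have OpC: "Op = open_cone K \<inter> {t. \<forall>v\<in>F. 0 < t v}"
  proof (intro equalityI subsetI)
    fix t assume t: "t \<in> Op"
    then have "{v. t v \<noteq> 0} = F" by (force simp: Op_def)
    moreover have "0 \<le> t v" for v
      using t by (cases "v \<in> F") (auto simp: Op_def less_imp_le)
    ultimately show "t \<in> open_cone K \<inter> {t. \<forall>v\<in>F. 0 < t v}"
      using F(1,2) t unfolding open_cone_def Op_def by (intro IntI CollectI conjI allI) simp_all
  next
    fix t assume t: "t \<in> open_cone K \<inter> {t. \<forall>v\<in>F. 0 < t v}"
    then have "F \<subseteq> {v. t v \<noteq> 0}" "{v. t v \<noteq> 0} \<in> K" by (auto simp: open_cone_def)
    then have "{v. t v \<noteq> 0} = F" using F(3) by metis
    then show "t \<in> Op" using t unfolding Op_def by blast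
  qed
  have "openin (top_of_set (open_cone K)) Op"
    unfolding OpC using open_all_coords_pos[OF fF] by (auto simp: openin_open)
  then have "openin (top_of_set (coord_space 4 - {\<lambda>_. 0})) (H ` Op)"
    using HG homeomorphism_imp_open_map by blast
  moreover have "openin (top_of_set (coord_space 4)) (coord_space 4 - {\<lambda>_. 0})"
    by (metis Diff_eq closed_singleton open_Compl openin_open)
  ultimately have openH: "openin (top_of_set (coord_space 4)) (H ` Op)"
    using openin_trans by blast
  have ne: "(\<lambda>v. if v \<in> F then 1 else 0) \<in> Op" by (auto simp: Op_def)
  have "n \<le> 4"
  proof (rule invariance_of_dimension_coord_space[OF openP])
    show "P \<noteq> {}" using qO[OF ne] by blast
    show "continuous_on P (H \<circ> p)"
      using pP OpC by (intro continuous_on_compose cp continuous_on_subset[OF cH]) auto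
    have "p x \<in> open_cone K" if "x \<in> P" for x using pP[OF that] OpC by blast
    then show "(H \<circ> p) ` P \<subseteq> coord_space 4"
      using HG by (fastforce simp: homeomorphism_def)
    show "inj_on (H \<circ> p) P"
    proof (rule inj_on_inverseI[where g="q \<circ> G"])
      show "(q \<circ> G) ((H \<circ> p) x) = x" if "x \<in> P" for x
        using HG pP[OF that] OpC qp[OF that] by (auto simp: homeomorphism_def)
    qed
  qed
  moreover have "4 \<le> n"
  proof (rule invariance_of_dimension_coord_space[OF openH])
    have GH: "G y \<in> Op" "H (G y) = y" if "y \<in> H ` Op" for y
      using HG that OpC by (auto simp: homeomorphism_def)
    show "H ` Op \<noteq> {}" using ne by blast
    show "continuous_on (H ` Op) (q \<circ> G)"
      using HG OpC by (intro continuous_on_compose cq continuous_on_subset[OF cG]) (auto simp: homeomorphism_def)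
    show "(q \<circ> G) ` H ` Op \<subseteq> coord_space n"
      using GH(1) qO by (auto simp: P_def)
    show "inj_on (q \<circ> G) (H ` Op)"
    proof (rule inj_on_inverseI[where g="H \<circ> p"])
      show "(H \<circ> p) ((q \<circ> G) y) = y" if "y \<in> H ` Op" for y
        using GH[OF that] pq by auto
    qed
  qed
  ultimately show ?thesis by (simp add: n_def)
qed

text \<open>The first two tetrahedra already fill a neighbourhood of the open triangle: together
  they are parametrised by an open subset of 4-space, and invariance of domain makes its image open.
  Points of the third tetrahedron near the triangle would lie in this image, where the weight at
  \<open>c\<close> is zero.\<close>

lemma sphere_no_three_facets_at_triangle:
  assumes K: "simplicial_3_sphere K" and \<tau>: "card \<tau> = 3"
    and abc: "a \<notin> \<tau>" "b \<notin> \<tau>" "c \<notin> \<tau>" "a \<noteq> b" "a \<noteq> c" "b \<noteq> c"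
    and faces: "insert a \<tau> \<in> K" "insert b \<tau> \<in> K" "insert c \<tau> \<in> K"
  shows False
proof -
  obtain H G where HG: "homeomorphism (open_cone K) (coord_space 4 - {\<lambda>_. 0}) H G"
    using sphere_cone_homeomorphism[OF K] .
  then have cH: "continuous_on (open_cone K) H" and cG: "continuous_on (coord_space 4 - {\<lambda>_. 0}) G"
    by (simp_all add: homeomorphism_def)
  have f\<tau>: "finite \<tau>" using \<tau> card.infinite by force
  have \<tau>K: "\<tau> \<in> K" using K faces(1) by (auto simp: simplicial_3_sphere_def abstract_complex_def)
  obtain e where e: "bij_betw e {..<3::nat} \<tau>"
    using f\<tau> \<tau> ex_bij_betw_nat_finite by (metis atLeast0LessThan)
  define e' where "e' = inv_into {..<3} e"
  have e': "\<And>v. v \<in> \<tau> \<Longrightarrow> e' v < 3 \<and> e (e' v) = v" "\<And>i. i < 3 \<Longrightarrow> e i \<in> \<tau> \<and> e' (e i) = i"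
    using e by (auto simp: e'_def bij_betw_def inv_into_into f_inv_into_f inv_into_f_f)
  define P where "P = {x \<in> coord_space 4. \<forall>i<3. 0 < x i}"
  \<comment> \<open>The sign of \<open>x 3\<close> chooses the side of the triangle: weight on
    \<open>a\<close> if it is positive, on \<open>b\<close> if it is negative.\<close>
  define p where "p x = (\<lambda>v. if v \<in> \<tau> then x (e' v) else if v = a then max (x 3) 0
      else if v = b then max (- x 3) 0 else 0)" for x :: "nat \<Rightarrow> real"
  define q where "q t = (\<lambda>i. if i < 3 then t (e i) else if i = 3 then t a - t b else (0::real))" for t
  have openP: "openin (top_of_set (coord_space 4)) P"
  proof -
    have "P = coord_space 4 \<inter> {t. \<forall>v\<in>{..<3}. 0 < t v}" by (auto simp: P_def)
    then show ?thesis using open_all_coords_pos[of "{..<3::nat}"] by (auto simp: openin_open)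
  qed
  have pC: "p x \<in> open_cone K" if "x \<in> P" for x
  proof -
    have "\<tau> \<noteq> {}" using \<tau> by auto
    moreover have pos: "x (e' v) > 0" if "v \<in> \<tau>" for v using that \<open>x \<in> P\<close> e' by (auto simp: P_def)
    then have "{v. p x v \<noteq> 0} = (if x 3 > 0 then insert a \<tau> else if x 3 < 0 then insert b \<tau> else \<tau>)"
      using abc by (auto simp: p_def max_def split: if_splits) force+
    moreover have nonneg: "0 \<le> p x v" for v using pos by (auto simp: p_def less_imp_le)
    ultimately have "{v. p x v \<noteq> 0} \<in> K" "{v. p x v \<noteq> 0} \<noteq> {}"
      using faces \<tau>K by (metis insert_not_empty)+
    then show ?thesis using nonneg by (simp add: open_cone_def)
  qed
  have qp: "q (p x) = x" if "x \<in> P" for x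
  proof
    fix i
    have "i \<ge> 4 \<or> i < 3 \<or> i = (3::nat)" by auto
    then show "q (p x) i = x i"
      using that e'(2)[of i] abc by (auto simp: q_def p_def P_def coord_space_def)
  qed
  have cp: "continuous_on A p" for A
    unfolding p_def
  proof (intro continuous_on_coordinatewise_then_product)
    fix v
    show "continuous_on A (\<lambda>x. if v \<in> \<tau> then x (e' v) else if v = a then max (x 3) 0
      else if v = b then max (- x 3) 0 else 0)"
      by (cases "v \<in> \<tau>"; cases "v = a"; cases "v = b") (simp_all add: continuous_on_max continuous_on_minus continuous_on_apply)
  qed
  have "openin (top_of_set (coord_space 4)) ((H \<circ> p) ` P)"
  proof (rule invariance_of_domain_coord_space[OF openP])
    show "continuous_on P (H \<circ> p)"
      using pC by (intro continuous_on_compose cp continuous_on_subset[OF cH]) auto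
    show "(H \<circ> p) ` P \<subseteq> coord_space 4"
      using HG pC by (auto simp: homeomorphism_def)
    show "inj_on (H \<circ> p) P"
    proof (rule inj_on_inverseI[where g="q \<circ> G"])
      show "(q \<circ> G) ((H \<circ> p) x) = x" if "x \<in> P" for x
        using HG pC[OF that] qp[OF that] by (auto simp: homeomorphism_def)
    qed
  qed
  then obtain W where W: "open W" "(H \<circ> p) ` P = coord_space 4 \<inter> W"
    by (auto simp: openin_open)
  \<comment> \<open>A segment from an interior point of the triangle into the third tetrahedron; its
    starting point is \<open>p x0\<close>, so it begins inside the open image.\<close>
  define l where "l \<epsilon> = (\<lambda>v. if v \<in> \<tau> then 1 else if v = c then \<epsilon> else 0)" for \<epsilon> :: real
  have lC: "l \<epsilon> \<in> open_cone K" if "\<epsilon> \<in> {0..1}" for \<epsilon>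
  proof -
    have "{v. l \<epsilon> v \<noteq> 0} = (if \<epsilon> = 0 then \<tau> else insert c \<tau>)" using abc by (auto simp: l_def)
    moreover have "\<tau> \<noteq> {}" using \<tau> by auto
    ultimately have "{v. l \<epsilon> v \<noteq> 0} \<in> K" "{v. l \<epsilon> v \<noteq> 0} \<noteq> {}"
      using faces \<tau>K by (metis insert_not_empty)+
    moreover have "0 \<le> l \<epsilon> v" for v using that by (simp add: l_def)
    ultimately show ?thesis by (simp add: open_cone_def)
  qed
  have "continuous_on {0..1} l"
    unfolding l_def
  proof (intro continuous_on_coordinatewise_then_product)
    fix v
    show "continuous_on {0..1} (\<lambda>\<epsilon>. if v \<in> \<tau> then 1 else if v = c then \<epsilon> else (0::real))"
      by (cases "v \<in> \<tau>"; cases "v = c") (auto intro!: continuous_intros)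
  qed
  then have "continuous_on {0..1} (H \<circ> l)"
    using lC by (intro continuous_on_compose continuous_on_subset[OF cH]) auto
  then have "openin (top_of_set {0..1}) ({0..1} \<inter> (H \<circ> l) -` W)"
    using W(1) continuous_openin_preimage_gen by blast
  then obtain V where V: "open V" "{0..1} \<inter> (H \<circ> l) -` W = {0..1} \<inter> V"
    by (auto simp: openin_open)
  define x0 where "x0 = (\<lambda>i. if i < (3::nat) then 1 else (0::real))"
  have "x0 \<in> P" by (auto simp: x0_def P_def coord_space_def)
  moreover have "p x0 = l 0" using e' by (auto simp: p_def l_def x0_def)
  ultimately have "(H \<circ> l) 0 \<in> W" using W(2) by force
  then have "0 \<in> {0..1} \<inter> (H \<circ> l) -` W" by simp
  then have "0 \<in> V" unfolding V(2) by simp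
  then obtain d where d: "d > 0" "ball 0 d \<subseteq> V" using V(1) by (metis open_contains_ball)
  define \<epsilon> where "\<epsilon> = min 1 (d/2)"
  have \<epsilon>: "\<epsilon> \<in> {0..1}" "\<epsilon> > 0" "\<epsilon> \<in> V" using d by (auto simp: \<epsilon>_def subset_iff dist_real_def)
  have "\<epsilon> \<in> {0..1} \<inter> (H \<circ> l) -` W" unfolding V(2) using \<epsilon> by simp
  then have "H (l \<epsilon>) \<in> W" by simp
  moreover have "H (l \<epsilon>) \<in> coord_space 4" using HG lC[OF \<epsilon>(1)] by (auto simp: homeomorphism_def)
  ultimately obtain x where x: "x \<in> P" "H (l \<epsilon>) = H (p x)" using W(2) by (metis (no_types, lifting) IntI comp_apply image_iff)
  then have "l \<epsilon> = p x" using HG lC[OF \<epsilon>(1)] pC by (metis homeomorphism_def)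
  then have "l \<epsilon> c = p x c" by simp
  then show False using abc \<epsilon>(2) by (auto simp: l_def p_def)
qed


section \<open>Shellings\<close>

lemma shellable_complex_pure: "shellable_complex d K \<Longrightarrow> pure_complex d K"
proof (induction rule: shellable_complex.induct)
  case (simplexI d C)
  then obtain \<sigma> where "finite \<sigma>" "face_dim \<sigma> = d" "C = Pow \<sigma>"
    by (auto simp: simplex_complex_def)
  then show ?case
    by (auto simp: pure_complex_def abstract_complex_def intro: finite_subset)
qed

text \<open>Passage from the recursive definition to an order of the facets. When \<open>F\<close>
  is glued on, purity of \<open>C1 \<inter> C2\<close> extends \<open>Fs ! i \<inter> F\<close> to a
  face of dimension d - 1 that is maximal in the intersection; by maximality this face equals
  \<open>Fs ! k \<inter> F\<close> for an earlier facet \<open>Fs ! k\<close> that contains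
  it.\<close>

lemma shellable_complex_shelling:
  assumes "shellable_complex d K"
  shows "\<exists>Fs. Fs \<noteq> [] \<and> K = (\<Union>F\<in>set Fs. Pow F) \<and> (\<forall>F\<in>set Fs. finite F \<and> face_dim F = d) \<and>
    (\<forall>j<length Fs. \<forall>i<j. \<exists>k<j. Fs ! i \<inter> Fs ! j \<subseteq> Fs ! k \<and> face_dim (Fs ! k \<inter> Fs ! j) = d - 1)"
  using assms
proof (induction rule: shellable_complex.induct)
  case (simplexI d C)
  then obtain \<sigma> where "finite \<sigma>" "face_dim \<sigma> = d" "C = Pow \<sigma>"
    by (auto simp: simplex_complex_def)
  then show ?case by (intro exI[of _ "[\<sigma>]"]) auto
next
  case (glueI d C1 C2)
  from glueI.IH(1) obtain Fs where Fs: "Fs \<noteq> []" "C1 = (\<Union>F\<in>set Fs. Pow F)"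
    "\<forall>F\<in>set Fs. finite F \<and> face_dim F = d"
    "\<forall>j<length Fs. \<forall>i<j. \<exists>k<j. Fs ! i \<inter> Fs ! j \<subseteq> Fs ! k \<and> face_dim (Fs ! k \<inter> Fs ! j) = d - 1"
    by blast
  obtain F where F: "finite F" "face_dim F = d" "C2 = Pow F"
    using glueI.hyps(4) by (auto simp: simplex_complex_def)
  have pure: "pure_complex (d - 1) (C1 \<inter> C2)"
    using glueI.hyps(5) by (rule shellable_complex_pure)
  have new: "\<exists>k<length Fs. Fs ! i \<inter> F \<subseteq> Fs ! k \<and> face_dim (Fs ! k \<inter> F) = d - 1"
    if "i < length Fs" for i
  proof -
    have mem: "Fs ! k \<inter> F \<in> C1 \<inter> C2" if "k < length Fs" for k
      using that Fs(2) F(3) by auto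
    have "finite (C1 \<inter> C2)" using F by simp
    from finite_has_maximal2[OF this mem[OF that]] obtain \<tau> where
      \<tau>: "\<tau> \<in> C1 \<inter> C2" "Fs ! i \<inter> F \<subseteq> \<tau>" "\<And>\<rho>. \<rho> \<in> C1 \<inter> C2 \<Longrightarrow> \<tau> \<subseteq> \<rho> \<Longrightarrow> \<rho> = \<tau>"
      by metis
    from \<tau>(1) obtain k where k: "k < length Fs" "\<tau> \<subseteq> Fs ! k" "\<tau> \<subseteq> F"
      using Fs(2) F(3) by (auto simp: in_set_conv_nth)
    then have "Fs ! k \<inter> F = \<tau>" using \<tau>(3)[OF mem[OF k(1)]] by blast
    moreover have "face_dim \<tau> = d - 1"
      using pure \<tau>(1,3) unfolding pure_complex_def by blast
    ultimately show ?thesis using k \<tau>(2) by blast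
  qed
  show ?case
  proof (intro exI[of _ "Fs @ [F]"] conjI allI impI)
    show "C1 \<union> C2 = (\<Union>F\<in>set (Fs @ [F]). Pow F)" using Fs(2) F(3) by auto
    show "\<forall>F\<in>set (Fs @ [F]). finite F \<and> face_dim F = d" using Fs(3) F by auto
    fix j i assume "j < length (Fs @ [F])" "i < j"
    then consider "j < length Fs" "i < j" | "j = length Fs" "i < length Fs" by fastforce
    then show "\<exists>k<j. (Fs @ [F]) ! i \<inter> (Fs @ [F]) ! j \<subseteq> (Fs @ [F]) ! k \<and>
        face_dim ((Fs @ [F]) ! k \<inter> (Fs @ [F]) ! j) = d - 1"
    proof cases
      case 1
      then obtain k where "k < j" "Fs ! i \<inter> Fs ! j \<subseteq> Fs ! k" "face_dim (Fs ! k \<inter> Fs ! j) = d - 1"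
        using Fs(4) by blast
      then show ?thesis using 1 by (intro exI[of _ k]) (auto simp: nth_append)
    next
      case 2
      then obtain k where "k < j" "Fs ! i \<inter> F \<subseteq> Fs ! k" "face_dim (Fs ! k \<inter> F) = d - 1"
        using new by blast
      then show ?thesis using 2 by (intro exI[of _ k]) (auto simp: nth_append)
    qed
  qed simp
qed

text \<open>The interface between topology and counting. The condition \<open>shelling\<close> is
  the usual one on a shelling order. \<open>thin\<close> speaks of facets as sets; positions can be
  used instead once the facets are known to be distinct.\<close>

locale thin_shelling =
  fixes Fs :: "'a set list"
  assumes nonempty: "Fs \<noteq> []"
    and card_facet: "\<And>j. j < length Fs \<Longrightarrow> card (Fs ! j) = 4"
    and shelling: "\<And>i j. j < length Fs \<Longrightarrow> i < j \<Longrightarrow>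
      \<exists>k<j. Fs ! i \<inter> Fs ! j \<subseteq> Fs ! k \<and> card (Fs ! k \<inter> Fs ! j) = 3"
    and thin: "\<And>\<tau> A B C. card \<tau> = 3 \<Longrightarrow> A \<in> set Fs \<Longrightarrow> B \<in> set Fs \<Longrightarrow> C \<in> set Fs \<Longrightarrow>
      \<tau> \<subseteq> A \<Longrightarrow> \<tau> \<subseteq> B \<Longrightarrow> \<tau> \<subseteq> C \<Longrightarrow> A = B \<or> A = C \<or> B = C"

lemma shellable_3_sphere_thin_shelling:
  assumes K: "simplicial_3_sphere K" and sh: "shellable K"
  obtains Fs where "thin_shelling Fs" "K = (\<Union>F\<in>set Fs. Pow F)" "sphere_facets K = set Fs"
proof -
  have ac: "abstract_complex K" using K by (simp add: simplicial_3_sphere_def)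
  then have finK: "finite K" by (simp add: abstract_complex_def)
  obtain d where d: "shellable_complex d K" using sh by (auto simp: shellable_def)
  obtain H G where HG: "homeomorphism (open_cone K) (coord_space 4 - {\<lambda>_. 0}) H G"
    using sphere_cone_homeomorphism[OF K] .
  \<comment> \<open>Punctured 4-space has a point, so \<open>K\<close> has a nonempty maximal face;
    its four vertices and purity pin the dimension \<open>d\<close> to 3.\<close>
  have "(\<lambda>i. if i = 0 then 1 else 0) \<in> coord_space 4 - {\<lambda>_. 0}"
    by (auto simp: coord_space_def fun_eq_iff)
  then have "open_cone K \<noteq> {}" using HG by (auto simp: homeomorphism_def)
  then obtain \<sigma> where "\<sigma> \<in> K" "\<sigma> \<noteq> {}" unfolding open_cone_def by blast
  with finite_has_maximal2[OF finK] obtain F where F: "F \<in> K" "F \<noteq> {}"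
    "\<And>\<tau>. \<tau> \<in> K \<Longrightarrow> F \<subseteq> \<tau> \<Longrightarrow> \<tau> = F"
    by (metis subset_empty)
  then have "face_dim F = d"
    using shellable_complex_pure[OF d] unfolding pure_complex_def by blast
  moreover have "card F = 4" by (rule sphere_maximal_face_card[OF K F])
  ultimately have d3: "d = 3" by (simp add: face_dim_def)
  obtain Fs where Fs: "Fs \<noteq> []" "K = (\<Union>F\<in>set Fs. Pow F)"
    "\<forall>F\<in>set Fs. finite F \<and> face_dim F = 3"
    "\<forall>j<length Fs. \<forall>i<j. \<exists>k<j. Fs ! i \<inter> Fs ! j \<subseteq> Fs ! k \<and> face_dim (Fs ! k \<inter> Fs ! j) = 2"
    using shellable_complex_shelling[OF d] d3 by auto
  have card4: "finite F \<and> card F = 4" if "F \<in> set Fs" for F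
    using Fs(3) that by (force simp: face_dim_def)
  have ins: "\<exists>v. v \<notin> \<tau> \<and> F = insert v \<tau>" if "card \<tau> = 3" "\<tau> \<subseteq> F" "F \<in> set Fs" for \<tau> F
  proof -
    have "card (F - \<tau>) = 1"
      using that card4[OF that(3)] finite_subset[OF that(2)] by (simp add: card_Diff_subset)
    then obtain v where "F - \<tau> = {v}" by (auto simp: card_1_singleton_iff)
    then show ?thesis using that(2) by blast
  qed
  have "thin_shelling Fs"
  proof
    show "Fs \<noteq> []" by (rule Fs)
    show "card (Fs ! j) = 4" if "j < length Fs" for j using card4 that by simp
    show "\<exists>k<j. Fs ! i \<inter> Fs ! j \<subseteq> Fs ! k \<and> card (Fs ! k \<inter> Fs ! j) = 3"
      if "j < length Fs" "i < j" for i j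
    proof -
      obtain k where "k < j" "Fs ! i \<inter> Fs ! j \<subseteq> Fs ! k" "face_dim (Fs ! k \<inter> Fs ! j) = 2"
        using Fs(4) \<open>j < length Fs\<close> \<open>i < j\<close> by blast
      then show ?thesis by (intro exI[of _ k]) (auto simp: face_dim_def)
    qed
    fix \<tau> A B C
    assume *: "card \<tau> = 3" "A \<in> set Fs" "B \<in> set Fs" "C \<in> set Fs" "\<tau> \<subseteq> A" "\<tau> \<subseteq> B" "\<tau> \<subseteq> C"
    obtain a b c where abc: "a \<notin> \<tau>" "A = insert a \<tau>" "b \<notin> \<tau>" "B = insert b \<tau>" "c \<notin> \<tau>" "C = insert c \<tau>"
      using ins[OF *(1,5,2)] ins[OF *(1,6,3)] ins[OF *(1,7,4)] by blast
    moreover have "A \<in> K" "B \<in> K" "C \<in> K" using Fs(2) * by auto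
    ultimately have "a = b \<or> a = c \<or> b = c"
      using sphere_no_three_facets_at_triangle[OF K *(1), of a b c] by blast
    then show "A = B \<or> A = C \<or> B = C" using abc by blast
  qed
  moreover have "sphere_facets K = set Fs"
  proof
    show "set Fs \<subseteq> sphere_facets K" using Fs(2,3) by (auto simp: sphere_facets_def)
    show "sphere_facets K \<subseteq> set Fs"
    proof
      fix \<sigma> assume "\<sigma> \<in> sphere_facets K"
      then obtain F where "F \<in> set Fs" "\<sigma> \<subseteq> F" "card \<sigma> = 4"
        using Fs(2) by (auto simp: sphere_facets_def face_dim_def)
      then show "\<sigma> \<in> set Fs" using card4 card_subset_eq by metis
    qed
  qed
  ultimately show thesis using Fs(2) that by blast
qed

text \<open>Lets a triangle of a labelled facet be named by the slot opposite to it, as letters of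
  addresses and marks do.\<close>

lemma three_subset_image:
  assumes "bij_betw g {..<4::nat} F" "\<tau> \<subseteq> F" "card \<tau> = 3"
  obtains b where "b < 4" "\<tau> = g ` ({..<4} - {b})"
proof -
  have g: "inj_on g {..<4}" "g ` {..<4} = F" using assms(1) by (auto simp: bij_betw_def)
  have F: "finite F" "card F = 4"
    using assms(1) bij_betw_finite bij_betw_same_card by fastforce+
  have "card (F - \<tau>) = 1"
    using F assms(2,3) finite_subset[OF assms(2)] by (simp add: card_Diff_subset)
  then obtain v where v: "F - \<tau> = {v}" by (auto simp: card_1_singleton_iff)
  then have "v \<in> g ` {..<4}" using g(2) by auto
  then obtain b where b: "b < 4" "g b = v" by auto
  have "\<tau> = F - {v}" using v assms(2) by auto
  also have "\<dots> = g ` ({..<4} - {b})"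
    using g b by (simp add: inj_on_image_set_diff[OF g(1)])
  finally show thesis using that b by blast
qed

lemma inj_image_Diff_insert:
  assumes "inj_on g {..<4::nat}" "c < 4"
  shows "g ` ({..<4} - {b}) - {g c} = g ` ({..<4} - {b, c})"
  using assms by (auto simp: inj_on_def)

section \<open>Distinct facets and the closing of edges\<close>

context thin_shelling
begin

lemma finite_facet: "j < length Fs \<Longrightarrow> finite (Fs ! j)"
  using card_facet[of j] card.infinite by fastforce

text \<open>For equal facets, the triangle \<open>Fs ! k \<inter> Fs ! j\<close> of the shelling
  condition would be all of \<open>Fs ! j\<close>.\<close>

lemma facet_distinct:
  assumes "j < length Fs" "i < j"
  shows "Fs ! i \<noteq> Fs ! j"
proof
  assume eq: "Fs ! i = Fs ! j"
  obtain k where "Fs ! i \<inter> Fs ! j \<subseteq> Fs ! k" "card (Fs ! k \<inter> Fs ! j) = 3"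
    using shelling[OF assms] by blast
  then have "Fs ! k \<inter> Fs ! j = Fs ! j" using eq by blast
  then show False using \<open>card _ = 3\<close> card_facet[OF assms(1)] by simp
qed

lemma distinct_facets: "distinct Fs"
  unfolding distinct_conv_nth using facet_distinct by (metis nat_neq_iff)

lemma card_triangles_at_edge:
  assumes "j < length Fs" "e \<subseteq> Fs ! j" "card e = 2"
  shows "finite {\<tau>. card \<tau> = 3 \<and> e \<subseteq> \<tau> \<and> \<tau> \<subseteq> Fs ! j}"
    and "card {\<tau>. card \<tau> = 3 \<and> e \<subseteq> \<tau> \<and> \<tau> \<subseteq> Fs ! j} = 2"
proof -
  let ?F = "Fs ! j"
  have F: "finite ?F" "card ?F = 4" using finite_facet card_facet assms(1) by auto
  have fe: "finite e" using F(1) assms(2) finite_subset by blast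
  have eq: "{\<tau>. card \<tau> = 3 \<and> e \<subseteq> \<tau> \<and> \<tau> \<subseteq> ?F} = (\<lambda>v. insert v e) ` (?F - e)"
  proof (intro equalityI subsetI)
    fix \<tau> assume "\<tau> \<in> {\<tau>. card \<tau> = 3 \<and> e \<subseteq> \<tau> \<and> \<tau> \<subseteq> ?F}"
    then have \<tau>: "card \<tau> = 3" "e \<subseteq> \<tau>" "\<tau> \<subseteq> ?F" by auto
    then have "card (\<tau> - e) = 1" using assms(3) fe by (simp add: card_Diff_subset)
    then obtain v where "\<tau> - e = {v}" by (auto simp: card_1_singleton_iff)
    then have "\<tau> = insert v e" "v \<in> ?F - e" using \<tau> by auto
    then show "\<tau> \<in> (\<lambda>v. insert v e) ` (?F - e)" by blast
  next
    fix \<tau> assume "\<tau> \<in> (\<lambda>v. insert v e) ` (?F - e)"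
    then show "\<tau> \<in> {\<tau>. card \<tau> = 3 \<and> e \<subseteq> \<tau> \<and> \<tau> \<subseteq> ?F}"
      using assms fe by auto
  qed
  have "inj_on (\<lambda>v. insert v e) (?F - e)" by (auto simp: inj_on_def)
  then have "card ((\<lambda>v. insert v e) ` (?F - e)) = 2"
    using F assms fe by (simp add: card_image card_Diff_subset)
  then show "finite {\<tau>. card \<tau> = 3 \<and> e \<subseteq> \<tau> \<and> \<tau> \<subseteq> ?F}"
    "card {\<tau>. card \<tau> = 3 \<and> e \<subseteq> \<tau> \<and> \<tau> \<subseteq> ?F} = 2"
    unfolding eq using F by auto
qed

text \<open>The moment at which the tetrahedra around an edge close up: both triangles of the new
  facet at \<open>e\<close> are old.\<close>

definition closed_at :: "'a set \<Rightarrow> nat \<Rightarrow> bool" where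
  "closed_at e j \<longleftrightarrow> card e = 2 \<and> j < length Fs \<and> e \<subseteq> Fs ! j \<and>
     (\<forall>\<tau>. card \<tau> = 3 \<and> e \<subseteq> \<tau> \<and> \<tau> \<subseteq> Fs ! j \<longrightarrow> (\<exists>i<j. \<tau> \<subseteq> Fs ! i))"

text \<open>Counting flags at \<open>e\<close>: if \<open>m\<close> facets contain \<open>e\<close>, then at least \<open>m\<close> triangles do, by
  thinness. But the first of these facets contributes two new triangles, every later one at most
  one, and one that closes \<open>e\<close> none.\<close>

lemma closed_at_unique:
  assumes j1: "closed_at e j1" and j2: "closed_at e j2"
  shows "j1 = j2"
proof (rule ccontr)
  assume neq: "j1 \<noteq> j2"
  have e2: "card e = 2" using j1 by (simp add: closed_at_def)
  define T where "T j = {\<tau>. card \<tau> = 3 \<and> e \<subseteq> \<tau> \<and> \<tau> \<subseteq> Fs ! j}" for j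
  define New where "New j = {\<tau> \<in> T j. \<forall>i<j. \<not> \<tau> \<subseteq> Fs ! i}" for j
  define J where "J = {j. j < length Fs \<and> e \<subseteq> Fs ! j}"
  have T: "finite (T j)" "card (T j) = 2" if "j \<in> J" for j
    using card_triangles_at_edge e2 that by (auto simp: T_def J_def)
  have fJ: "finite J" by (simp add: J_def)
  have J12: "j1 \<in> J" "j2 \<in> J" using j1 j2 by (auto simp: closed_at_def J_def)
  define j0 where "j0 = Min J"
  have j0: "j0 \<in> J" "\<And>j. j \<in> J \<Longrightarrow> j0 \<le> j"
    unfolding j0_def using J12(1) by (metis Min_in fJ empty_iff, metis Min_le fJ)
  \<comment> \<open>A facet that closes \<open>e\<close> shares a triangle at \<open>e\<close> with
    an earlier facet, so it is not the first one at \<open>e\<close>.\<close>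
  have j0_neq: "j0 \<noteq> j" if cl: "closed_at e j" for j
  proof -
    have "j \<in> J" using cl by (auto simp: closed_at_def J_def)
    then have "T j \<noteq> {}" using T(2) by fastforce
    then obtain \<tau> where "\<tau> \<in> T j" by blast
    then obtain i where "i < j" "\<tau> \<subseteq> Fs ! i"
      using cl unfolding closed_at_def T_def by blast
    moreover have "e \<subseteq> \<tau>" "j < length Fs" using \<open>\<tau> \<in> T j\<close> \<open>j \<in> J\<close> by (simp_all add: T_def J_def)
    ultimately have "i \<in> J" unfolding J_def by (intro CollectI conjI) (simp, rule subset_trans)
    then show ?thesis using j0(2)[of i] \<open>i < j\<close> by simp
  qed
  have New_closed: "New j = {}" if "closed_at e j" for j
    using that unfolding New_def T_def closed_at_def by blast
  have New_le: "card (New j) \<le> 2" if "j \<in> J" for j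
    using T[OF that] card_mono[of "T j" "New j"] by (auto simp: New_def)
  have New_later: "card (New j) \<le> 1" if j: "j \<in> J" "j \<noteq> j0" for j
  proof -
    have "j0 < j" using j0(2)[OF j(1)] j(2) by simp
    moreover have "j < length Fs" "e \<subseteq> Fs ! j" "e \<subseteq> Fs ! j0" using j(1) j0(1) by (simp_all add: J_def)
    \<comment> \<open>The shelling condition is applied to \<open>j0\<close> because
      \<open>e\<close> lies in both \<open>Fs ! j0\<close> and \<open>Fs ! j\<close>; this forces
      the shared triangle to contain \<open>e\<close>.\<close>
    ultimately obtain k where k: "k < j" "Fs ! j0 \<inter> Fs ! j \<subseteq> Fs ! k" "card (Fs ! k \<inter> Fs ! j) = 3"
      using shelling by metis
    have "Fs ! k \<inter> Fs ! j \<in> T j"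
      using k \<open>e \<subseteq> Fs ! j\<close> \<open>e \<subseteq> Fs ! j0\<close> unfolding T_def by blast
    moreover have "New j \<subseteq> T j - {Fs ! k \<inter> Fs ! j}" using k(1) by (auto simp: New_def)
    ultimately show ?thesis
      using T[OF j(1)] card_mono[of "T j - {Fs ! k \<inter> Fs ! j}" "New j"] by simp
  qed
  define Tr where "Tr = (\<Union>j\<in>J. T j)"
  have fTr: "finite Tr" using fJ T by (simp add: Tr_def)
  have Tr_New: "Tr \<subseteq> (\<Union>j\<in>J. New j)"
  proof
    fix \<tau> assume "\<tau> \<in> Tr"
    then obtain j where j: "j \<in> J" "\<tau> \<in> T j" by (auto simp: Tr_def)
    define i where "i = (LEAST i. \<tau> \<subseteq> Fs ! i)"
    have \<tau>: "\<tau> \<subseteq> Fs ! j" "e \<subseteq> \<tau>" "j < length Fs" using j by (simp_all add: T_def J_def)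
    have i: "\<tau> \<subseteq> Fs ! i" "i \<le> j"
      unfolding i_def using \<tau>(1) by (rule LeastI, rule Least_le)
    have min: "\<not> \<tau> \<subseteq> Fs ! i'" if "i' < i" for i' using that unfolding i_def by (rule not_less_Least)
    have "i \<in> J" using i \<tau> unfolding J_def by (metis (mono_tags) le_less_trans mem_Collect_eq subset_trans)
    moreover have "\<tau> \<in> New i" using i(1) min j(2) by (simp add: T_def New_def)
    ultimately show "\<tau> \<in> (\<Union>j\<in>J. New j)" by (rule UN_I)
  qed
  have "card Tr \<le> card (\<Union>j\<in>J. New j)"
  proof (rule card_mono[OF _ Tr_New], rule finite_UN_I[OF fJ])
    show "finite (New j)" if "j \<in> J" for j using T(1)[OF that] by (simp add: New_def)
  qed
  also have "\<dots> \<le> (\<Sum>j\<in>J. card (New j))" by (rule card_UN_le[OF fJ])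
  also have "\<dots> = (\<Sum>j\<in>J - {j0, j1, j2}. card (New j)) + (\<Sum>j\<in>{j0, j1, j2}. card (New j))"
    using fJ J12 j0 by (intro sum.subset_diff) auto
  also have "(\<Sum>j\<in>{j0, j1, j2}. card (New j)) = card (New j0)"
    using j0_neq[OF j1] j0_neq[OF j2] neq New_closed[OF j1] New_closed[OF j2] by auto
  also have "(\<Sum>j\<in>J - {j0, j1, j2}. card (New j)) \<le> (\<Sum>j\<in>J - {j0, j1, j2}. 1)"
    using New_later by (intro sum_mono) auto
  also have "\<dots> = card J - 3"
    using fJ J12 j0(1) j0_neq[OF j1] j0_neq[OF j2] neq by (simp add: card_Diff_subset)
  \<comment> \<open>Three facets have left the sum and at most two triangles return for
    \<open>j0\<close>, so triangles are fewer than facets. Subtraction is truncated, hence the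
    separate bound \<open>3 \<le> card J\<close>.\<close>
  finally have "card Tr \<le> card J - 3 + 2" using New_le[OF j0(1)] by simp
  moreover have "3 \<le> card J"
    using card_mono[OF fJ, of "{j0, j1, j2}"] J12 j0(1) j0_neq[OF j1] j0_neq[OF j2] neq by simp
  moreover have "card J \<le> card Tr"
  proof -
    have thinJ: "card {j \<in> J. \<tau> \<in> T j} \<le> 2" if "\<tau> \<in> Tr" for \<tau>
    proof (rule ccontr)
      assume "\<not> card {j \<in> J. \<tau> \<in> T j} \<le> 2"
      then have "3 \<le> card {j \<in> J. \<tau> \<in> T j}" by simp
      then obtain S where S: "S \<subseteq> {j \<in> J. \<tau> \<in> T j}" "card S = 3"
        by (meson obtain_subset_with_card_n)
      then obtain a b c where "S = {a, b, c}" and neq3: "a \<noteq> b" "a \<noteq> c" "b \<noteq> c"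
        unfolding card_3_iff by blast
      then have abc: "a \<in> J" "b \<in> J" "c \<in> J" "\<tau> \<in> T a" "\<tau> \<in> T b" "\<tau> \<in> T c"
        using S(1) by simp_all
      then have "Fs ! a = Fs ! b \<or> Fs ! a = Fs ! c \<or> Fs ! b = Fs ! c"
        by (intro thin[of \<tau>]) (simp_all add: T_def J_def)
      then show False
        using abc(1-3) neq3 distinct_facets by (auto simp: J_def nth_eq_iff_index_eq)
    qed
    have "{\<tau> \<in> Tr. \<tau> \<in> T j} = T j" if "j \<in> J" for j using that by (auto simp: Tr_def)
    then have "2 * card J = (\<Sum>\<tau>\<in>Tr. card {j \<in> J. \<tau> \<in> T j})"
      using sum_multicount[OF fTr fJ, of "\<lambda>\<tau> j. \<tau> \<in> T j" 2] T by simp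
    also have "\<dots> \<le> (\<Sum>\<tau>\<in>Tr. 2)" using thinJ by (rule sum_mono)
    finally show ?thesis by simp
  qed
  ultimately show False by simp
qed

end


section \<open>Encoding by marked trees\<close>

text \<open>Each facet hangs on an earlier one along a shared triangle, and the new letter is the
  slot opposite to that triangle in the parent. The labelling \<open>\<phi>\<close> takes words as
  arguments, because positions in the shelling are to be forgotten.\<close>

lemma (in thin_shelling) addresses_exist:
  assumes "0 < m" "m \<le> length Fs"
  shows "\<exists>ws \<phi>. length ws = m \<and> ws ! 0 = [] \<and> distinct ws \<and>
    (\<forall>j<m. bij_betw (\<phi> (ws ! j)) {..<4::nat} (Fs ! j)) \<and>
    (\<forall>j<m. 0 < j \<longrightarrow> (\<exists>i<j. \<exists>a<4. ws ! j = ws ! i @ [a] \<and> card (Fs ! i \<inter> Fs ! j) = 3 \<and>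
       (\<forall>x<4. x \<noteq> a \<longrightarrow> \<phi> (ws ! j) x = \<phi> (ws ! i) x)))"
  using assms
proof (induction m)
  case (Suc m)
  show ?case
  proof (cases "m = 0")
    case True
    have "0 < length Fs" using nonempty by simp
    then obtain g where "bij_betw g {..<4::nat} (Fs ! 0)"
      using ex_bij_betw_nat_finite[OF finite_facet] card_facet by (metis atLeast0LessThan)
    then show ?thesis using True
      by (intro exI[of _ "[[]]"] exI[of _ "\<lambda>_. g"]) simp
  next
    case False
    with Suc obtain ws \<phi> where ws: "length ws = m" "ws ! 0 = []" "distinct ws"
      and bij: "\<And>j. j < m \<Longrightarrow> bij_betw (\<phi> (ws ! j)) {..<4::nat} (Fs ! j)"
      and tree: "\<And>j. j < m \<Longrightarrow> 0 < j \<Longrightarrow> \<exists>i<j. \<exists>a<4. ws ! j = ws ! i @ [a] \<and> card (Fs ! i \<inter> Fs ! j) = 3 \<and>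
       (\<forall>x<4. x \<noteq> a \<longrightarrow> \<phi> (ws ! j) x = \<phi> (ws ! i) x)"
      by (metis Suc_leD neq0_conv)
    have m: "m < length Fs" using Suc.prems by simp
    obtain i where i: "i < m" "card (Fs ! i \<inter> Fs ! m) = 3"
      using shelling[OF m, of 0] False by blast
    obtain a where a: "a < 4" "Fs ! i \<inter> Fs ! m = \<phi> (ws ! i) ` ({..<4} - {a})"
      using three_subset_image[OF bij[OF i(1)] Int_lower1 i(2)] .
    have "card (Fs ! m - Fs ! i) = 1"
      using i(2) card_facet[OF m] finite_facet[OF m] card_Diff_subset_Int[of "Fs ! m" "Fs ! i"]
      by (simp add: Int_commute)
    then obtain v where v: "Fs ! m - Fs ! i = {v}" by (auto simp: card_1_singleton_iff)
    let ?w = "ws ! i @ [a]"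
    \<comment> \<open>If facet \<open>k\<close> already had this word, it would hang on the same
      parent along the same triangle; the facets at \<open>i\<close>, \<open>k\<close> and
      \<open>m\<close> would then violate thinness.\<close>
    have new: "?w \<notin> set ws"
    proof
      assume "?w \<in> set ws"
      then obtain k where k: "k < m" "ws ! k = ?w" using ws(1) by (auto simp: in_set_conv_nth)
      then have "0 < k" using ws(2) by (cases k) auto
      then obtain i' a' where i': "i' < k" "ws ! k = ws ! i' @ [a']"
        "\<forall>x<4. x \<noteq> a' \<longrightarrow> \<phi> (ws ! k) x = \<phi> (ws ! i') x"
        using tree[OF k(1)] by blast
      then have "ws ! i' = ws ! i" "a' = a" using k(2) by auto
      then have "i' = i" using ws(1,3) i(1) i'(1) k(1) by (simp add: nth_eq_iff_index_eq)
      have "\<phi> (ws ! i) ` ({..<4} - {a}) \<subseteq> Fs ! k"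
      proof
        fix u assume "u \<in> \<phi> (ws ! i) ` ({..<4} - {a})"
        then obtain x where "x < 4" "x \<noteq> a" "u = \<phi> (ws ! i) x" by auto
        then have "u = \<phi> (ws ! k) x" "x \<in> {..<4}" using i'(3) \<open>i' = i\<close> \<open>a' = a\<close> by simp_all
        then show "u \<in> Fs ! k" using bij[OF k(1)] by (auto simp: bij_betw_def)
      qed
      then have "Fs ! i = Fs ! k \<or> Fs ! i = Fs ! m \<or> Fs ! k = Fs ! m"
        using i k(1) m a(2) by (intro thin[of "Fs ! i \<inter> Fs ! m"]) auto
      then show False using distinct_facets i(1) k(1) m i'(1) \<open>i' = i\<close>
        by (auto simp: nth_eq_iff_index_eq)
    qed
    \<comment> \<open>The new vertex takes the slot of the vertex it replaces, and the other three
      slots are inherited. Freshness of the word protects the earlier labels.\<close>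
    define \<psi> where "\<psi> = \<phi>(?w := (\<phi> (ws ! i))(a := v))"
    have \<psi>_old: "\<psi> (ws ! j) = \<phi> (ws ! j)" if "j < m" for j
      using new that ws(1) nth_mem[of j ws] unfolding \<psi>_def by (metis fun_upd_other)
    have \<psi>_new: "\<psi> ?w = (\<phi> (ws ! i))(a := v)" by (simp add: \<psi>_def)
    have img: "(\<phi> (ws ! i))(a := v) ` {..<4} = Fs ! m"
    proof -
      have "(\<phi> (ws ! i))(a := v) ` {..<4} = insert v (\<phi> (ws ! i) ` ({..<4} - {a}))"
        using a(1) by (auto simp: image_iff)
      also have "\<dots> = Fs ! m" using v a(2) by blast
      finally show ?thesis .
    qed
    have bij_new: "bij_betw (\<psi> ?w) {..<4} (Fs ! m)"
      unfolding \<psi>_new bij_betw_def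
    proof (rule conjI[OF _ img])
      have "card ((\<phi> (ws ! i))(a := v) ` {..<4}) = card {..<4::nat}"
        unfolding img card_facet[OF m] by simp
      then show "inj_on ((\<phi> (ws ! i))(a := v)) {..<4}"
        by (rule eq_card_imp_inj_on[OF finite_lessThan])
    qed
    show ?thesis
    proof (intro exI[of _ "ws @ [?w]"] exI[of _ \<psi>] conjI allI impI)
      show "length (ws @ [?w]) = Suc m" using ws by simp
      show "(ws @ [?w]) ! 0 = []" using ws False by (simp add: nth_append)
      show "distinct (ws @ [?w])" using ws new by simp
      show "bij_betw (\<psi> ((ws @ [?w]) ! j)) {..<4} (Fs ! j)" if "j < Suc m" for j
        using that bij bij_new ws(1) by (cases "j = m") (simp_all add: nth_append \<psi>_old)
      fix j assume j: "j < Suc m" "0 < j"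
      show "\<exists>i<j. \<exists>a<4. (ws @ [?w]) ! j = (ws @ [?w]) ! i @ [a] \<and> card (Fs ! i \<inter> Fs ! j) = 3 \<and>
          (\<forall>x<4. x \<noteq> a \<longrightarrow> \<psi> ((ws @ [?w]) ! j) x = \<psi> ((ws @ [?w]) ! i) x)"
      proof (cases "j = m")
        case True
        show ?thesis
        proof (rule exI[of _ i], rule conjI[OF _ exI[of _ a]])
          show "i < j" using i True by simp
        qed (use i a(1) ws(1) True in \<open>simp add: nth_append \<psi>_old \<psi>_new\<close>)
      next
        case False
        then have "j < m" using j by simp
        then obtain i' a' where "i' < j" "a' < 4" "ws ! j = ws ! i' @ [a']" "card (Fs ! i' \<inter> Fs ! j) = 3"
          "\<forall>x<4. x \<noteq> a' \<longrightarrow> \<phi> (ws ! j) x = \<phi> (ws ! i') x"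
          using tree j(2) by blast
        note i' = this
        have "\<psi> (ws ! j) = \<phi> (ws ! j)" "\<psi> (ws ! i') = \<phi> (ws ! i')"
          using \<psi>_old \<open>j < m\<close> i'(1) by simp_all
        moreover have "(ws @ [?w]) ! j = ws ! j" "(ws @ [?w]) ! i' = ws ! i'"
          using ws(1) \<open>j < m\<close> i'(1) by (simp_all add: nth_append)
        ultimately show ?thesis using i' by metis
      qed
    qed
  qed
qed simp

definition slot_pairs :: "(nat \<times> nat) set" where
  "slot_pairs = {..<4} \<times> {..<4}"

text \<open>\<open>A\<close> is the tree of addresses, \<open>\<phi> w x\<close> the vertex in slot \<open>x\<close> of the facet with address \<open>w\<close>;
  the child of \<open>w\<close> along \<open>a\<close> replaces the vertex in slot \<open>a\<close>. A mark \<open>(w, b, c)\<close> says that the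
  triangle opposite to slot \<open>b\<close> is glued because it shares with its partner the edge that
  avoids the slots \<open>b\<close> and \<open>c\<close>. Two marked triangles with the same such edge coincide.\<close>

definition encodes ::
  "nat list set \<Rightarrow> (nat list \<times> nat \<times> nat) set \<Rightarrow> 'a set set \<Rightarrow> (nat list \<Rightarrow> nat \<Rightarrow> 'a) \<Rightarrow> bool" where
  "encodes A M K \<phi> \<longleftrightarrow>
     (\<forall>w\<in>A. inj_on (\<phi> w) {..<4}) \<and>
     K = (\<Union>w\<in>A. Pow (\<phi> w ` {..<4})) \<and>
     (\<forall>w a. w @ [a] \<in> A \<longrightarrow> w \<in> A \<and> (\<forall>x<4. x \<noteq> a \<longrightarrow> \<phi> (w @ [a]) x = \<phi> w x)) \<and>
     M \<subseteq> A \<times> slot_pairs \<and> (\<forall>w b c. (w, b, c) \<in> M \<longrightarrow> b \<noteq> c) \<and>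
     (\<forall>w b c w' b' c'. (w, b, c) \<in> M \<longrightarrow> (w', b', c') \<in> M \<longrightarrow>
        \<phi> w ` ({..<4} - {b, c}) = \<phi> w' ` ({..<4} - {b', c'}) \<longrightarrow> \<phi> w c = \<phi> w' c') \<and>
     (\<exists>ws. set ws = A \<and>
        (\<forall>j<length ws. \<forall>i<j. \<forall>x<4. \<phi> (ws ! j) x \<in> \<phi> (ws ! i) ` {..<4} \<longrightarrow>
          (\<exists>k<j. \<exists>a. a \<noteq> x \<and> ws ! j = ws ! k @ [a]) \<or>
          (\<exists>p<j. \<exists>k<j. \<exists>b b' c'. ws ! j = ws ! p @ [x] \<and>
             (ws ! j, b, x) \<in> M \<and> (ws ! k, b', c') \<in> M \<and> \<phi> (ws ! j) x = \<phi> (ws ! k) c' \<and>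
             \<phi> (ws ! j) ` ({..<4} - {b, x}) = \<phi> (ws ! k) ` ({..<4} - {b', c'}))))"

lemma (in thin_shelling) encodes_exists:
  obtains ws M \<phi> where "length ws = length Fs" "ws ! 0 = []"
    "\<And>j. j < length ws \<Longrightarrow> 0 < j \<Longrightarrow> \<exists>i<j. \<exists>a<4. ws ! j = ws ! i @ [a]"
    "encodes (set ws) M (\<Union>F\<in>set Fs. Pow F) \<phi>"
proof -
  let ?N = "length Fs"
  obtain ws \<phi> where ws: "length ws = ?N" "ws ! 0 = []" "distinct ws"
    and bij: "\<And>j. j < ?N \<Longrightarrow> bij_betw (\<phi> (ws ! j)) {..<4::nat} (Fs ! j)"
    and tree: "\<And>j. j < ?N \<Longrightarrow> 0 < j \<Longrightarrow> \<exists>i<j. \<exists>a<4. ws ! j = ws ! i @ [a] \<and> card (Fs ! i \<inter> Fs ! j) = 3 \<and>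
       (\<forall>x<4. x \<noteq> a \<longrightarrow> \<phi> (ws ! j) x = \<phi> (ws ! i) x)"
    using addresses_exist[of ?N] nonempty by (metis length_greater_0_conv order_refl)
  have inj: "inj_on (\<phi> (ws ! j)) {..<4}" and img: "\<phi> (ws ! j) ` {..<4} = Fs ! j" if "j < ?N" for j
    using bij[OF that] by (auto simp: bij_betw_def)
  \<comment> \<open>The triangle along which facet \<open>j\<close> hangs on its parent. For
    \<open>j = 0\<close> the word is empty and \<open>last\<close> is unspecified, but
    \<open>t j\<close> is evaluated only where an earlier facet exists.\<close>
  define t where "t j = \<phi> (ws ! j) ` ({..<4} - {last (ws ! j)})" for j
  define Cl where "Cl = {(\<tau>, \<tau> \<inter> t j) | \<tau> j k. j < ?N \<and> k < j \<and> \<tau> = Fs ! k \<inter> Fs ! j \<and> card \<tau> = 3 \<and> \<tau> \<noteq> t j}"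
  \<comment> \<open>Membership depends only on the triangle and the edge as vertex sets, so both
    facets at a glued triangle carry the mark, and the code does not tell which of them came
    first.\<close>
  define M where "M = {(w, b, c). w \<in> set ws \<and> b < 4 \<and> c < 4 \<and> b \<noteq> c \<and>
    (\<phi> w ` ({..<4} - {b}), \<phi> w ` ({..<4} - {b, c})) \<in> Cl}"
  have parent: "\<exists>i<j. \<exists>a<4. ws ! j = ws ! i @ [a] \<and> (\<forall>x<4. x \<noteq> a \<longrightarrow> \<phi> (ws ! j) x = \<phi> (ws ! i) x) \<and>
      t j = Fs ! i \<inter> Fs ! j \<and> card (t j) = 3 \<and> last (ws ! j) = a" if j: "j < ?N" "0 < j" for j
  proof -
    obtain i a where i: "i < j" "a < 4" "ws ! j = ws ! i @ [a]" "card (Fs ! i \<inter> Fs ! j) = 3"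
      "\<forall>x<4. x \<noteq> a \<longrightarrow> \<phi> (ws ! j) x = \<phi> (ws ! i) x"
      using tree[OF j] by blast
    have tj: "t j = \<phi> (ws ! j) ` ({..<4} - {a})" by (simp add: t_def i(3))
    also have "\<dots> = \<phi> (ws ! i) ` ({..<4} - {a})"
      using i(5) by (intro image_cong) auto
    finally have sub: "t j \<subseteq> Fs ! i \<inter> Fs ! j"
      using tj img[OF j(1)] img[of i] i(1) j(1) by auto
    have c3: "card (t j) = 3"
      unfolding tj
      using inj_on_subset[OF inj[OF j(1)], of "{..<4} - {a}"] i(2) by (simp add: card_image)
    then have "t j = Fs ! i \<inter> Fs ! j"
      using sub i(4) finite_facet[OF j(1)] by (intro card_subset_eq) auto
    then show ?thesis using i c3 by (intro exI[of _ i] exI[of _ a]) simp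
  qed
  \<comment> \<open>The two triangles meet in an edge and are the only triangles of facet
    \<open>j\<close> there. Both are old, so facet \<open>j\<close> closes the edge.\<close>
  have Cl_edge: "card (\<tau> \<inter> t j) = 2 \<and> (\<forall>\<rho>. card \<rho> = 3 \<and> \<tau> \<inter> t j \<subseteq> \<rho> \<and> \<rho> \<subseteq> Fs ! j \<longrightarrow> \<rho> = \<tau> \<or> \<rho> = t j)
      \<and> closed_at (\<tau> \<inter> t j) j"
    if j: "j < ?N" "k < j" "\<tau> = Fs ! k \<inter> Fs ! j" "card \<tau> = 3" "\<tau> \<noteq> t j" for \<tau> j k
  proof -
    obtain i where i: "i < j" "t j = Fs ! i \<inter> Fs ! j" "card (t j) = 3"
      using parent[OF j(1)] j(2) by auto
    have fin: "finite (Fs ! j)" and c4: "card (Fs ! j) = 4" using finite_facet card_facet j(1) by auto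
    obtain x where x: "x < 4" "\<tau> = \<phi> (ws ! j) ` ({..<4} - {x})"
      using three_subset_image[OF bij[OF j(1)], of \<tau>] j(3,4) by blast
    obtain y where y: "y < 4" "t j = \<phi> (ws ! j) ` ({..<4} - {y})"
      using three_subset_image[OF bij[OF j(1)], of "t j"] i(2,3) by blast
    let ?g = "\<phi> (ws ! j)"
    have "x \<noteq> y" using x y j(5) by auto
    have e: "\<tau> \<inter> t j = ?g ` ({..<4} - {x, y})"
    proof -
      have "\<tau> \<inter> t j = ?g ` (({..<4} - {x}) \<inter> ({..<4} - {y}))"
        unfolding x(2) y(2) using inj[OF j(1)] by (intro inj_on_image_Int[symmetric]) auto
      also have "({..<4} - {x}) \<inter> ({..<4} - {y}) = {..<4} - {x, y}" by blast
      finally show ?thesis .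
    qed
    have c2: "card (\<tau> \<inter> t j) = 2"
      unfolding e using inj_on_subset[OF inj[OF j(1)], of "{..<4} - {x, y}"] x(1) y(1) \<open>x \<noteq> y\<close>
      by (simp add: card_image card_Diff_subset)
    have two: "\<rho> = \<tau> \<or> \<rho> = t j" if \<rho>: "card \<rho> = 3" "\<tau> \<inter> t j \<subseteq> \<rho>" "\<rho> \<subseteq> Fs ! j" for \<rho>
    proof -
      obtain z where z: "z < 4" "\<rho> = ?g ` ({..<4} - {z})"
        using three_subset_image[OF bij[OF j(1)] \<rho>(3,1)] .
      have "{..<4} - {x, y} \<subseteq> {..<4} - {z}"
        using \<rho>(2) inj[OF j(1)] unfolding e z(2) by (subst (asm) inj_on_image_subset_iff) auto
      then have "z = x \<or> z = y" using z(1) by blast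
      then show ?thesis using x y z by blast
    qed
    have "closed_at (\<tau> \<inter> t j) j"
      unfolding closed_at_def
    proof (intro conjI allI impI)
      show "card (\<tau> \<inter> t j) = 2" by (rule c2)
      show "j < ?N" by (rule j)
      show "\<tau> \<inter> t j \<subseteq> Fs ! j" using j(3) by blast
      show "\<exists>i<j. \<rho> \<subseteq> Fs ! i" if "card \<rho> = 3 \<and> \<tau> \<inter> t j \<subseteq> \<rho> \<and> \<rho> \<subseteq> Fs ! j" for \<rho>
      proof -
        have "\<rho> = \<tau> \<or> \<rho> = t j" using two that by blast
        then show ?thesis
        proof
          assume "\<rho> = \<tau>" then show ?thesis using j(2,3) by blast
        next
          assume "\<rho> = t j" then show ?thesis using i(1,2) by blast
        qed
      qed
    qed
    then show ?thesis using c2 two by blast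
  qed
  \<comment> \<open>The edge determines \<open>j\<close> by \<open>closed_at_unique\<close>, and
    then \<open>\<tau>\<close> is the triangle of facet \<open>j\<close> at this edge other than
    \<open>t j\<close>.\<close>
  have Cl_inj: "\<tau> = \<tau>'" if Cl: "(\<tau>, e) \<in> Cl" "(\<tau>', e) \<in> Cl" for \<tau> \<tau>' e
  proof -
    obtain j k where j: "j < ?N" "k < j" "\<tau> = Fs ! k \<inter> Fs ! j" "card \<tau> = 3" "\<tau> \<noteq> t j" "e = \<tau> \<inter> t j"
      using Cl(1) unfolding Cl_def by blast
    obtain j' k' where j': "j' < ?N" "k' < j'" "\<tau>' = Fs ! k' \<inter> Fs ! j'" "card \<tau>' = 3" "\<tau>' \<noteq> t j'" "e = \<tau>' \<inter> t j'"
      using Cl(2) unfolding Cl_def by blast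
    have "j = j'"
      using Cl_edge[OF j(1-5)] Cl_edge[OF j'(1-5)] j(6) j'(6) closed_at_unique by metis
    moreover have "\<tau> \<inter> t j \<subseteq> \<tau>'" "\<tau>' \<subseteq> Fs ! j" using j(6) j'(3,6) \<open>j = j'\<close> by blast+
    ultimately show ?thesis using Cl_edge[OF j(1-5)] j'(4,5) by blast
  qed
  have "encodes (set ws) M (\<Union>F\<in>set Fs. Pow F) \<phi>"
    unfolding encodes_def
  proof (intro conjI)
    show "\<forall>w\<in>set ws. inj_on (\<phi> w) {..<4}"
      using inj ws(1) by (metis in_set_conv_nth)
    show "(\<Union>F\<in>set Fs. Pow F) = (\<Union>w\<in>set ws. Pow (\<phi> w ` {..<4}))"
    proof -
      have "set Fs = (\<lambda>w. \<phi> w ` {..<4}) ` set ws"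
      proof -
        have "Fs = map (\<lambda>w. \<phi> w ` {..<4}) ws" using ws(1) img by (intro nth_equalityI) simp_all
        then show ?thesis by (metis set_map)
      qed
      then show ?thesis by simp
    qed
    show "\<forall>w a. w @ [a] \<in> set ws \<longrightarrow> w \<in> set ws \<and> (\<forall>x<4. x \<noteq> a \<longrightarrow> \<phi> (w @ [a]) x = \<phi> w x)"
    proof (intro allI impI)
      fix w a assume "w @ [a] \<in> set ws"
      then obtain j where j: "j < ?N" "ws ! j = w @ [a]" using ws(1) by (metis in_set_conv_nth)
      then have "0 < j" using ws(2) by (cases j) auto
      then obtain i a' where "i < j" "ws ! j = ws ! i @ [a']" "\<forall>x<4. x \<noteq> a' \<longrightarrow> \<phi> (ws ! j) x = \<phi> (ws ! i) x"
        using parent[OF j(1)] by blast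
      moreover have "ws ! i \<in> set ws" using \<open>i < j\<close> j(1) ws(1) by simp
      ultimately show "w \<in> set ws \<and> (\<forall>x<4. x \<noteq> a \<longrightarrow> \<phi> (w @ [a]) x = \<phi> w x)"
        using j(2) by simp
    qed
    show "M \<subseteq> set ws \<times> slot_pairs" by (auto simp: M_def slot_pairs_def)
    show "\<forall>w b c. (w, b, c) \<in> M \<longrightarrow> b \<noteq> c" by (auto simp: M_def)
    show "\<forall>w b c w' b' c'. (w, b, c) \<in> M \<longrightarrow> (w', b', c') \<in> M \<longrightarrow>
        \<phi> w ` ({..<4} - {b, c}) = \<phi> w' ` ({..<4} - {b', c'}) \<longrightarrow> \<phi> w c = \<phi> w' c'"
    proof (intro allI impI)
      fix w b c w' b' c'
      assume m: "(w, b, c) \<in> M" "(w', b', c') \<in> M"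
        and e: "\<phi> w ` ({..<4} - {b, c}) = \<phi> w' ` ({..<4} - {b', c'})"
      have *: "\<phi> w ` ({..<4} - {b}) - \<phi> w ` ({..<4} - {b, c}) = {\<phi> w c}" if m': "(w, b, c) \<in> M" for w b c
      proof -
        have w: "w \<in> set ws" "c < 4" "b \<noteq> c" using m' by (auto simp: M_def)
        then have "inj_on (\<phi> w) {..<4}" using inj ws(1) by (metis in_set_conv_nth)
        then show ?thesis using w by (auto simp: inj_on_def)
      qed
      have "\<phi> w ` ({..<4} - {b}) = \<phi> w' ` ({..<4} - {b'})"
        using m e by (intro Cl_inj) (auto simp: M_def)
      then show "\<phi> w c = \<phi> w' c'" using *[OF m(1)] *[OF m(2)] e by simp
    qed
    show "\<exists>us. set us = set ws \<and>
        (\<forall>j<length us. \<forall>i<j. \<forall>x<4. \<phi> (us ! j) x \<in> \<phi> (us ! i) ` {..<4} \<longrightarrow>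
          (\<exists>k<j. \<exists>a. a \<noteq> x \<and> us ! j = us ! k @ [a]) \<or>
          (\<exists>p<j. \<exists>k<j. \<exists>b b' c'. us ! j = us ! p @ [x] \<and>
             (us ! j, b, x) \<in> M \<and> (us ! k, b', c') \<in> M \<and> \<phi> (us ! j) x = \<phi> (us ! k) c' \<and>
             \<phi> (us ! j) ` ({..<4} - {b, x}) = \<phi> (us ! k) ` ({..<4} - {b', c'})))"
    proof (intro exI[of _ ws] conjI allI impI refl)
      fix j i x
      assume j: "j < length ws" "i < j" and x: "x < 4" "\<phi> (ws ! j) x \<in> \<phi> (ws ! i) ` {..<4}"
      let ?v = "\<phi> (ws ! j) x"
      have jN: "j < ?N" using j ws(1) by simp
      obtain p a where p: "p < j" "a < 4" "ws ! j = ws ! p @ [a]" "t j = Fs ! p \<inter> Fs ! j" "last (ws ! j) = a"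
        using parent[OF jN] j(2) by auto
      show "(\<exists>k<j. \<exists>a. a \<noteq> x \<and> ws ! j = ws ! k @ [a]) \<or>
          (\<exists>p<j. \<exists>k<j. \<exists>b b' c'. ws ! j = ws ! p @ [x] \<and>
             (ws ! j, b, x) \<in> M \<and> (ws ! k, b', c') \<in> M \<and> ?v = \<phi> (ws ! k) c' \<and>
             \<phi> (ws ! j) ` ({..<4} - {b, x}) = \<phi> (ws ! k) ` ({..<4} - {b', c'}))"
      proof (cases "a = x")
        case False
        then show ?thesis using p by blast
      next
        case True
        have v: "?v \<in> Fs ! i \<inter> Fs ! j" using x img[OF jN] img[of i] j(2) jN by auto
        \<comment> \<open>Slot \<open>x\<close> holds the one vertex of facet \<open>j\<close>
          outside its parent, and this vertex is old. The shelling condition gives a shared triangle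
          that contains it; as \<open>t j\<close> does not, this triangle is marked.\<close>
        obtain k where k: "k < j" "Fs ! i \<inter> Fs ! j \<subseteq> Fs ! k" "card (Fs ! k \<inter> Fs ! j) = 3"
          using shelling[OF jN j(2)] by blast
        have kN: "k < ?N" using k jN by simp
        define \<tau> where "\<tau> = Fs ! k \<inter> Fs ! j"
        have v\<tau>: "?v \<in> \<tau>" using v k(2) by (auto simp: \<tau>_def)
        have tj: "t j = Fs ! j - {?v}"
          unfolding t_def p(5) True img[OF jN, symmetric] using inj[OF jN] x(1)
          by (auto simp: inj_on_def)
        then have "\<tau> \<noteq> t j" using v\<tau> by blast
        then have Cl: "(\<tau>, \<tau> \<inter> t j) \<in> Cl"
          unfolding Cl_def using jN k \<tau>_def by blast
        have edge: "\<tau> \<inter> t j = \<tau> - {?v}" unfolding tj by (auto simp: \<tau>_def)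
        have c3: "card \<tau> = 3" using k(3) by (simp add: \<tau>_def)
        obtain b where b: "b < 4" "\<tau> = \<phi> (ws ! j) ` ({..<4} - {b})"
          using three_subset_image[OF bij[OF jN], of \<tau>] c3 by (auto simp: \<tau>_def)
        have "b \<noteq> x" using v\<tau> inj[OF jN] b x(1) by (auto simp: inj_on_def)
        have e1: "\<tau> \<inter> t j = \<phi> (ws ! j) ` ({..<4} - {b, x})"
          unfolding edge unfolding b(2) by (rule inj_image_Diff_insert[OF inj[OF jN] x(1)])
        obtain b' where b': "b' < 4" "\<tau> = \<phi> (ws ! k) ` ({..<4} - {b'})"
          using three_subset_image[OF bij[OF kN], of \<tau>] c3 by (auto simp: \<tau>_def)
        then obtain c' where c': "c' < 4" "c' \<noteq> b'" "?v = \<phi> (ws ! k) c'" using v\<tau> by auto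
        have e2: "\<tau> \<inter> t j = \<phi> (ws ! k) ` ({..<4} - {b', c'})"
          unfolding edge c'(3) unfolding b'(2) by (rule inj_image_Diff_insert[OF inj[OF kN] c'(1)])
        have "(ws ! j, b, x) \<in> M"
          using Cl b \<open>b \<noteq> x\<close> x(1) j(1) e1 by (simp add: M_def)
        moreover have "(ws ! k, b', c') \<in> M"
          using Cl b' c' kN ws(1) e2 by (simp add: M_def)
        ultimately show ?thesis using p True k(1) c'(3) e1 e2 by metis
      qed
    qed
  qed
  then show thesis using that[of ws M \<phi>] ws tree by metis
qed

section \<open>Decoding: a code determines the complex up to isomorphism\<close>

text \<open>The induction follows the order that belongs to \<open>\<phi>\<close>. Each coincidence
  there is either inherited along the tree or produced by two marks with a common edge, and both
  rules hold for \<open>\<psi>\<close> as well, whatever its own order.\<close>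

lemma encodes_kernel_mono:
  assumes K: "encodes A M K \<phi>" and L: "encodes A M L \<psi>"
    and "u \<in> A" "w \<in> A" "x < 4" "y < 4" "\<phi> u x = \<phi> w y"
  shows "\<psi> u x = \<psi> w y"
proof -
  have inj: "\<And>w. w \<in> A \<Longrightarrow> inj_on (\<phi> w) {..<4}" "\<And>w. w \<in> A \<Longrightarrow> inj_on (\<psi> w) {..<4}"
    using K L by (simp_all add: encodes_def)
  have child: "\<And>w a x. w @ [a] \<in> A \<Longrightarrow> x < 4 \<Longrightarrow> x \<noteq> a \<Longrightarrow> \<phi> (w @ [a]) x = \<phi> w x"
    "\<And>w a x. w @ [a] \<in> A \<Longrightarrow> x < 4 \<Longrightarrow> x \<noteq> a \<Longrightarrow> \<psi> (w @ [a]) x = \<psi> w x"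
    using K L by (simp_all add: encodes_def)
  have M: "\<And>w b c. (w, b, c) \<in> M \<Longrightarrow> b < 4 \<and> c < 4 \<and> b \<noteq> c"
    using K by (auto simp: encodes_def slot_pairs_def)
  have "\<forall>w b c w' b' c'. (w, b, c) \<in> M \<longrightarrow> (w', b', c') \<in> M \<longrightarrow>
        \<psi> w ` ({..<4} - {b, c}) = \<psi> w' ` ({..<4} - {b', c'}) \<longrightarrow> \<psi> w c = \<psi> w' c'"
    using L unfolding encodes_def by (elim conjE)
  note mark = this[rule_format]
  obtain ws where ws: "set ws = A" and
    "\<forall>j<length ws. \<forall>i<j. \<forall>x<4. \<phi> (ws ! j) x \<in> \<phi> (ws ! i) ` {..<4} \<longrightarrow>
          (\<exists>k<j. \<exists>a. a \<noteq> x \<and> ws ! j = ws ! k @ [a]) \<or>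
          (\<exists>p<j. \<exists>k<j. \<exists>b b' c'. ws ! j = ws ! p @ [x] \<and>
             (ws ! j, b, x) \<in> M \<and> (ws ! k, b', c') \<in> M \<and> \<phi> (ws ! j) x = \<phi> (ws ! k) c' \<and>
             \<phi> (ws ! j) ` ({..<4} - {b, x}) = \<phi> (ws ! k) ` ({..<4} - {b', c'}))"
    using K unfolding encodes_def by (elim conjE exE)
  note step = this(2)[rule_format]
  have memA: "ws ! j \<in> A" if "j < length ws" for j using that ws by auto
  \<comment> \<open>Bounding both positions by \<open>n\<close> makes the hypothesis available for
    any two facets before facet \<open>n\<close>, such as its parent and its marked partner.\<close>
  have main: "\<forall>i j x y. i \<le> n \<longrightarrow> j \<le> n \<longrightarrow> i < length ws \<longrightarrow> j < length ws \<longrightarrow> x < 4 \<longrightarrow> y < 4 \<longrightarrow>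
    \<phi> (ws ! j) x = \<phi> (ws ! i) y \<longrightarrow> \<psi> (ws ! j) x = \<psi> (ws ! i) y" for n
  proof (induction n rule: less_induct)
    case (less n)
    have IH: "\<psi> (ws ! j) x = \<psi> (ws ! i) y"
      if "i < n" "j < n" "i < length ws" "j < length ws" "x < 4" "y < 4" "\<phi> (ws ! j) x = \<phi> (ws ! i) y"
      for i j x y
      using less[rule_format, of "max i j" i j x y] that by simp
    have new: "\<psi> (ws ! n) x = \<psi> (ws ! i) y"
      if n: "n < length ws" and i: "i < n" and xy: "x < 4" "y < 4" and eq: "\<phi> (ws ! n) x = \<phi> (ws ! i) y"
      for i x y
    proof -
      have iN: "i < length ws" using n i by simp
      have "\<phi> (ws ! n) x \<in> \<phi> (ws ! i) ` {..<4}" using eq xy by simp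
      from step[OF n i xy(1) this] show ?thesis
      proof (elim disjE exE conjE)
        fix k a assume k: "k < n" "a \<noteq> x" "ws ! n = ws ! k @ [a]"
        then have "ws ! k @ [a] \<in> A" using memA[OF n] by simp
        from child[OF this xy(1)] have "\<phi> (ws ! n) x = \<phi> (ws ! k) x" "\<psi> (ws ! n) x = \<psi> (ws ! k) x"
          using k by simp_all
        then show ?thesis using IH[of i k x y] i k(1) n xy eq by simp
      next
        fix p k b b' c'
        assume p: "p < n" "k < n" "ws ! n = ws ! p @ [x]"
          and m: "(ws ! n, b, x) \<in> M" "(ws ! k, b', c') \<in> M"
          and c': "\<phi> (ws ! n) x = \<phi> (ws ! k) c'"
          and e: "\<phi> (ws ! n) ` ({..<4} - {b, x}) = \<phi> (ws ! k) ` ({..<4} - {b', c'})"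
        have mem: "ws ! p @ [x] \<in> A" "ws ! k \<in> A" "p < length ws" "k < length ws"
          using memA[OF n] memA[of k] n p by simp_all
        \<comment> \<open>The edge avoids slot \<open>x\<close>, so its vertices occupy the same
          slots in the parent \<open>p\<close>. With \<open>p\<close> in place of facet
          \<open>n\<close>, the induction hypothesis carries the edge over to \<open>\<psi>\<close>.
          Both images have two vertices, so inclusion becomes equality and the marking rule for
          \<open>\<psi>\<close> applies.\<close>
        have "\<psi> (ws ! n) ` ({..<4} - {b, x}) \<subseteq> \<psi> (ws ! k) ` ({..<4} - {b', c'})"
        proof
          fix v assume "v \<in> \<psi> (ws ! n) ` ({..<4} - {b, x})"
          then obtain z where z: "z < 4" "z \<noteq> b" "z \<noteq> x" "v = \<psi> (ws ! n) z" by auto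
          then have "\<phi> (ws ! n) z \<in> \<phi> (ws ! k) ` ({..<4} - {b', c'})" unfolding e[symmetric] by simp
          then obtain z' where z': "z' < 4" "z' \<noteq> b'" "z' \<noteq> c'" "\<phi> (ws ! n) z = \<phi> (ws ! k) z'" by auto
          have "\<phi> (ws ! n) z = \<phi> (ws ! p) z" "\<psi> (ws ! n) z = \<psi> (ws ! p) z"
            using child[OF mem(1) z(1,3)] p(3) by simp_all
          then have "v = \<psi> (ws ! k) z'" using IH[of k p z z'] p(1,2) mem(3,4) z z' by simp
          then show "v \<in> \<psi> (ws ! k) ` ({..<4} - {b', c'})" using z' by simp
        qed
        moreover have "card (\<psi> w ` ({..<4} - {b, c})) = 2" if "w \<in> A" "(w, b, c) \<in> M" for w b c
          using inj_on_subset[OF inj(2)[OF that(1)], of "{..<4} - {b, c}"] M[OF that(2)]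
          by (simp add: card_image card_Diff_subset)
        ultimately have "\<psi> (ws ! n) ` ({..<4} - {b, x}) = \<psi> (ws ! k) ` ({..<4} - {b', c'})"
          using m memA[OF n] mem(2) by (intro card_subset_eq) simp_all
        then have "\<psi> (ws ! n) x = \<psi> (ws ! k) c'" using mark[OF m] by simp
        moreover have "c' < 4" using M[OF m(2)] by simp
        ultimately show ?thesis using IH[of i k c' y] p(2) i mem(4) iN xy c' eq by simp
      qed
    qed
    show ?case
    proof (intro allI impI)
      fix i j x y
      assume *: "i \<le> n" "j \<le> n" "i < length ws" "j < length ws" "x < 4" "y < 4" "\<phi> (ws ! j) x = \<phi> (ws ! i) y"
      consider "i < n" "j < n" | "i < n" "j = n" | "i = n" "j < n" | "i = n" "j = n"
        using *(1,2) by linarith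
      then show "\<psi> (ws ! j) x = \<psi> (ws ! i) y"
      proof cases
        case 1 then show ?thesis using IH * by blast
      next
        case 2 then show ?thesis using new * by blast
      next
        case 3 then show ?thesis using new[of j y x] * by simp
      next
        case 4
        then have "x = y" using * inj(1)[OF memA[OF *(3)]] by (simp add: inj_on_eq_iff)
        then show ?thesis using 4 by simp
      qed
    qed
  qed
  obtain i j where "u = ws ! j" "w = ws ! i" "i < length ws" "j < length ws"
    using assms(3,4) ws by (metis in_set_conv_nth)
  then show ?thesis using main[rule_format, of i "max i j" j x y] assms(5-7) by simp
qed

text \<open>The vertex map is dictated by the slots. One inclusion of kernels makes it well defined,
  the opposite one makes it injective.\<close>

lemma encodes_imp_iso:
  assumes K: "encodes A M K \<phi>" "abstract_complex K" and L: "encodes A M L \<psi>" "abstract_complex L"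
  shows "(K, L) \<in> complex_iso"
proof -
  let ?P = "A \<times> {..<4::nat}"
  define f where "f v = (case SOME p. p \<in> ?P \<and> case_prod \<phi> p = v of (w, x) \<Rightarrow> \<psi> w x)" for v
  have f: "f (\<phi> w x) = \<psi> w x" if "w \<in> A" "x < 4" for w x
  proof -
    let ?p = "SOME p. p \<in> ?P \<and> case_prod \<phi> p = \<phi> w x"
    have "?p \<in> ?P \<and> case_prod \<phi> ?p = \<phi> w x"
      by (rule someI[of _ "(w, x)"]) (use that in simp)
    moreover obtain u y where "?p = (u, y)" by fastforce
    ultimately show ?thesis
      using encodes_kernel_mono[OF K(1) L(1), of u w y x] that by (simp add: f_def)
  qed
  have KL: "K = (\<Union>w\<in>A. Pow (\<phi> w ` {..<4}))" "L = (\<Union>w\<in>A. Pow (\<psi> w ` {..<4}))"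
    using K(1) L(1) by (simp_all add: encodes_def)
  then have verts: "\<Union>K = (\<Union>w\<in>A. \<phi> w ` {..<4})" "\<Union>L = (\<Union>w\<in>A. \<psi> w ` {..<4})" by auto
  have facet: "f ` \<phi> w ` {..<4} = \<psi> w ` {..<4}" if "w \<in> A" for w
    unfolding image_image using f that by (intro image_cong) auto
  have "(\<lambda>\<sigma>. f ` \<sigma>) ` K = L"
  proof -
    have "(\<lambda>\<sigma>. f ` \<sigma>) ` K = (\<Union>w\<in>A. (`) f ` Pow (\<phi> w ` {..<4}))"
      by (simp add: KL(1) image_UN)
    also have "\<dots> = (\<Union>w\<in>A. Pow (f ` \<phi> w ` {..<4}))"
      using image_Pow_surj[OF refl] by (intro SUP_cong refl) blast
    also have "\<dots> = L" using facet by (simp add: KL(2))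
    finally show ?thesis .
  qed
  moreover have "bij_betw f (\<Union>K) (\<Union>L)"
    unfolding bij_betw_def
  proof
    show "f ` \<Union>K = \<Union>L" unfolding verts image_UN using facet by simp
    show "inj_on f (\<Union>K)"
    proof (rule inj_onI)
      fix v v' assume v: "v \<in> \<Union>K" "v' \<in> \<Union>K" "f v = f v'"
      then obtain w x w' x' where "w \<in> A" "x < 4" "v = \<phi> w x" "w' \<in> A" "x' < 4" "v' = \<phi> w' x'"
        unfolding verts by auto
      then show "v = v'" using v(3) f encodes_kernel_mono[OF L(1) K(1), of w w' x x'] by simp
    qed
  qed
  ultimately show ?thesis using K(2) L(2) unfolding complex_iso_def by blast
qed

section \<open>Counting\<close>

text \<open>A walk in the tree of words: the move \<open>4\<close> goes back to the parent, a move \<open>a < 4\<close> goes down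
  along \<open>a\<close>.\<close>

fun visited :: "nat list \<Rightarrow> nat list \<Rightarrow> nat list set" where
  "visited w [] = {w}"
| "visited w (a # ms) = insert w (visited (if a = 4 then butlast w else w @ [a]) ms)"

lemma card_visited: "card (visited w ms) \<le> Suc (length ms)"
proof (induction ms arbitrary: w)
  case (Cons a ms)
  then show ?case by (auto intro: card_insert_le_m1 order_trans[OF card_insert_le_m1])
qed simp

lemma finite_visited: "finite (visited w ms)"
  by (induction ms arbitrary: w) auto

text \<open>At a moment when the walk stands at \<open>u\<close>, insert the detour
  \<open>a\<close>, \<open>4\<close>. It adds one word and returns to \<open>u\<close>, so the
  remaining moves act as before.\<close>

lemma visited_insert_leaf:
  assumes "u \<in> visited w ms" "a < 4"
  shows "\<exists>ms'. length ms' = length ms + 2 \<and> set ms' \<subseteq> set ms \<union> {a, 4} \<and>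
    visited w ms' = insert (u @ [a]) (visited w ms)"
  using assms(1)
proof (induction ms arbitrary: w)
  case Nil
  then show ?case using assms(2) by (intro exI[of _ "[a, 4]"]) auto
next
  case (Cons b ms)
  let ?w = "if b = 4 then butlast w else w @ [b]"
  show ?case
  proof (cases "u = w")
    case True
    then show ?thesis using assms(2) by (intro exI[of _ "a # 4 # b # ms"]) auto
  next
    case False
    then have "u \<in> visited ?w ms" using Cons.prems by simp
    from Cons.IH[OF this] obtain ms' where "length ms' = length ms + 2" "set ms' \<subseteq> set ms \<union> {a, 4}"
      "visited ?w ms' = insert (u @ [a]) (visited ?w ms)" by blast
    then show ?thesis by (intro exI[of _ "b # ms'"]) auto
  qed
qed

definition address_trees :: "nat \<Rightarrow> nat list set set" where
  "address_trees n = visited [] ` {ms. set ms \<subseteq> {..4} \<and> length ms = 2 * n}"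

lemma address_tree_of_list:
  assumes "length ws = Suc n" "ws ! 0 = []"
    and "\<And>j. j < length ws \<Longrightarrow> 0 < j \<Longrightarrow> \<exists>i<j. \<exists>a<4. ws ! j = ws ! i @ [a]"
  shows "set ws \<in> address_trees n"
  using assms
proof (induction n arbitrary: ws)
  case 0
  then have "ws = [[]]" by (cases ws) auto
  then show ?case by (simp add: address_trees_def)
next
  case (Suc n)
  obtain us w where us: "ws = us @ [w]" "length us = Suc n"
    using Suc.prems(1) by (metis length_Suc_conv_rev)
  have "us ! 0 = []" using Suc.prems(2) us by (simp add: nth_append)
  moreover have "\<exists>i<j. \<exists>a<4. us ! j = us ! i @ [a]" if j: "j < length us" "0 < j" for j
  proof -
    obtain i a where "i < j" "a < 4" "ws ! j = ws ! i @ [a]" using Suc.prems(3)[of j] j us by auto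
    then show ?thesis using j us by (intro exI[of _ i] conjI exI[of _ a]) (simp_all add: nth_append)
  qed
  ultimately have "set us \<in> address_trees n" using Suc.IH us(2) by blast
  then obtain ms where ms: "set ms \<subseteq> {..4}" "length ms = 2 * n" "set us = visited [] ms"
    by (auto simp: address_trees_def)
  obtain i a where ia: "i < Suc n" "a < 4" "ws ! Suc n = ws ! i @ [a]"
    using Suc.prems(3)[of "Suc n"] us by auto
  then have w: "w = us ! i @ [a]" "us ! i \<in> visited [] ms"
    using us by (simp_all add: nth_append flip: ms(3))
  from visited_insert_leaf[OF w(2) ia(2)] obtain ms' where
    ms': "length ms' = length ms + 2" "set ms' \<subseteq> set ms \<union> {a, 4}" "visited [] ms' = insert w (visited [] ms)"
    unfolding w(1) by blast
  have "set ws = visited [] ms'" using us ms(3) ms'(3) by simp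
  moreover have "set ms' \<subseteq> {..4}" using ms'(2) ms(1) ia(2) by auto
  ultimately show ?case unfolding address_trees_def using ms'(1) ms(2) by (intro image_eqI) auto
qed

lemma card_address_trees: "finite (address_trees n)" "card (address_trees n) \<le> 5 ^ (2 * n)"
proof -
  have fin: "finite {ms. set ms \<subseteq> {..4::nat} \<and> length ms = 2 * n}" by (rule finite_lists_length_eq) simp
  then show "finite (address_trees n)" by (simp add: address_trees_def)
  show "card (address_trees n) \<le> 5 ^ (2 * n)"
    unfolding address_trees_def using card_image_le[OF fin, of "visited []"]
    by (simp add: card_lists_length_eq)
qed

text \<open>An arbitrary walk of 2n moves may visit a new word at every move, hence 2n + 1 and not n
  + 1.\<close>

lemma card_address_tree:
  assumes "A \<in> address_trees n"
  shows "finite A" "card A \<le> 2 * n + 1"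
proof -
  obtain ms where "A = visited [] ms" "length ms = 2 * n"
    using assms by (auto simp: address_trees_def)
  then show "finite A" "card A \<le> 2 * n + 1"
    using finite_visited card_visited[of "[]" ms] by simp_all
qed

definition codes :: "nat \<Rightarrow> (nat list set \<times> (nat list \<times> nat \<times> nat) set) set" where
  "codes n = (SIGMA A:address_trees n. Pow (A \<times> slot_pairs))"

lemma card_codes: "finite (codes n)" "card (codes n) \<le> (2 ^ 53) ^ Suc n"
proof -
  have sl: "finite slot_pairs" "card slot_pairs = 16" by (simp_all add: slot_pairs_def)
  show "finite (codes n)"
    unfolding codes_def using card_address_trees card_address_tree sl by (intro finite_SigmaI) auto
  have "card (Pow (A \<times> slot_pairs)) \<le> 2 ^ (16 * (2 * n + 1))" if "A \<in> address_trees n" for A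
    using card_address_tree[OF that] sl by (simp add: card_Pow card_cartesian_product)
  then have "(\<Sum>A\<in>address_trees n. card (Pow (A \<times> slot_pairs))) \<le>
      (\<Sum>A\<in>address_trees n. 2 ^ (16 * (2 * n + 1)))"
    by (rule sum_mono)
  moreover have "card (codes n) = (\<Sum>A\<in>address_trees n. card (Pow (A \<times> slot_pairs)))"
    unfolding codes_def using card_address_trees(1) card_address_tree(1) sl(1)
    by (intro card_SigmaI) auto
  ultimately have "card (codes n) \<le> (\<Sum>A\<in>address_trees n. 2 ^ (16 * (2 * n + 1)))" by simp
  also have "\<dots> = card (address_trees n) * 2 ^ (16 * (2 * n + 1))" by simp
  also have "\<dots> \<le> 5 ^ (2 * n) * 2 ^ (16 * (2 * n + 1))"
    using card_address_trees by (intro mult_right_mono) auto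
  \<comment> \<open>Raising 5 to 8 leaves only powers of two: 6n bits for the tree and 16(2n + 1)
    for the marks, together 38n + 16.\<close>
  also have "\<dots> \<le> 8 ^ (2 * n) * 2 ^ (16 * (2 * n + 1))"
    by (intro mult_right_mono power_mono) auto
  also have "\<dots> = 2 ^ (38 * n + 16)"
  proof -
    have "(8::nat) ^ (2 * n) = 2 ^ (3 * (2 * n))" unfolding power_mult by simp
    then show ?thesis by (simp flip: power_add)
  qed
  \<comment> \<open>The comparison is 38n + 16 \<le> 53(n + 1), which the exponent 53 satisfies with
    room to spare.\<close>
  also have "\<dots> \<le> (2 ^ 53) ^ Suc n"
    unfolding power_mult[symmetric] by (intro power_increasing) auto
  finally show "card (codes n) \<le> (2 ^ 53) ^ Suc n" .
qed

section \<open>From spheres to codes, and the final count\<close>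

lemma shellable_3_sphere_code:
  assumes "simplicial_3_sphere K" "shellable K" "card (sphere_facets K) = N"
  obtains n A M \<phi> where "N = Suc n" "(A, M) \<in> codes n" "encodes A M K \<phi>"
proof -
  obtain Fs where Fs: "thin_shelling Fs" "K = (\<Union>F\<in>set Fs. Pow F)" "sphere_facets K = set Fs"
    using shellable_3_sphere_thin_shelling[OF assms(1,2)] .
  interpret thin_shelling Fs by (rule Fs)
  have "length Fs = N" using distinct_card[OF distinct_facets] Fs(3) assms(3) by simp
  moreover from this obtain n where n: "N = Suc n" using nonempty by (cases N) auto
  obtain ws M \<phi> where ws: "length ws = length Fs" "ws ! 0 = []"
    "\<And>j. j < length ws \<Longrightarrow> 0 < j \<Longrightarrow> \<exists>i<j. \<exists>a<4. ws ! j = ws ! i @ [a]"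
    and enc: "encodes (set ws) M (\<Union>F\<in>set Fs. Pow F) \<phi>"
    using encodes_exists by metis
  have "set ws \<in> address_trees n"
    using ws n \<open>length Fs = N\<close> by (intro address_tree_of_list) auto
  moreover have "M \<subseteq> set ws \<times> slot_pairs" using enc by (simp add: encodes_def)
  ultimately have "(set ws, M) \<in> codes n" by (simp add: codes_def)
  then show thesis using that n enc Fs(2) by blast
qed


theorem mainTheorem5:
  shows "\<exists>C::real. \<forall>N::nat.
           finite (shellable_3_sphere_types N) \<and>
           real (card (shellable_3_sphere_types N)) \<le> C ^ N"
proof (intro exI[of _ "2 ^ 53"] allI)
  fix N :: nat
  define X where "X = {K :: nat set set. simplicial_3_sphere K \<and> shellable K \<and> card (sphere_facets K) = N}"
  show "finite (shellable_3_sphere_types N) \<and> real (card (shellable_3_sphere_types N)) \<le> (2 ^ 53) ^ N"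
  proof (cases N)
    case 0
    \<comment> \<open>A shelling has a first facet, so the number of facets is a successor.\<close>
    then have "X = {}" unfolding X_def using shellable_3_sphere_code by fastforce
    then have "shellable_3_sphere_types N = {}"
      unfolding shellable_3_sphere_types_def X_def[symmetric] quotient_def by blast
    then show ?thesis by simp
  next
    case (Suc n)
    have "\<exists>c. c \<in> codes n \<and> (\<exists>\<phi>. encodes (fst c) (snd c) K \<phi>)" if "K \<in> X" for K
    proof -
      have K: "simplicial_3_sphere K" "shellable K" "card (sphere_facets K) = N"
        using that by (simp_all add: X_def)
      obtain m A M \<phi> where "N = Suc m" "(A, M) \<in> codes m" "encodes A M K \<phi>"
        by (rule shellable_3_sphere_code[OF K])
      then show ?thesis using Suc by (intro exI[of _ "(A, M)"]) auto
    qed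
    then have "\<exists>code. \<forall>K\<in>X. code K \<in> codes n \<and> (\<exists>\<phi>. encodes (fst (code K)) (snd (code K)) K \<phi>)"
      by (intro bchoice ballI)
    then obtain code where code: "\<And>K. K \<in> X \<Longrightarrow> code K \<in> codes n"
      and enc: "\<And>K. K \<in> X \<Longrightarrow> \<exists>\<phi>. encodes (fst (code K)) (snd (code K)) K \<phi>"
      by blast
    \<comment> \<open>Any sphere with code \<open>c\<close> represents the type of all of them. For
      a code that no sphere in \<open>X\<close> has, the choice is arbitrary, but this can only
      enlarge the image that covers the types.\<close>
    define type_of_code where "type_of_code c = complex_iso `` {SOME K. K \<in> X \<and> code K = c}" for c
    have "complex_iso `` {K} = type_of_code (code K)" if K: "K \<in> X" for K
    proof -
      define L where "L = (SOME L. L \<in> X \<and> code L = code K)"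
      have L: "L \<in> X" "code L = code K"
        using someI[of "\<lambda>L. L \<in> X \<and> code L = code K" K] K unfolding L_def by simp_all
      have "abstract_complex K" "abstract_complex L"
        using K L(1) by (simp_all add: X_def simplicial_3_sphere_def)
      then have "(K, L) \<in> complex_iso"
        using enc[OF K] enc[OF L(1)] L(2) encodes_imp_iso by metis
      then show ?thesis
        using equiv_class_eq[OF equiv_complex_iso] unfolding type_of_code_def L_def by blast
    qed
    then have sub: "shellable_3_sphere_types N \<subseteq> type_of_code ` codes n"
      unfolding shellable_3_sphere_types_def X_def[symmetric] quotient_def using code by blast
    have "card (shellable_3_sphere_types N) \<le> card (codes n)"
      using card_mono[OF finite_imageI[OF card_codes(1)] sub] card_image_le[OF card_codes(1), of type_of_code n]
      by (rule order_trans)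
    also have "\<dots> \<le> (2 ^ 53) ^ N" using card_codes(2)[of n] Suc by simp
    finally have "real (card (shellable_3_sphere_types N)) \<le> real ((2 ^ 53) ^ N)"
      by (rule of_nat_mono)
    then show ?thesis
      using finite_subset[OF sub finite_imageI[OF card_codes(1)]] by simp
  qed
qed

end
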